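(* Let $(M_c,\eta,H)$ be a contact Hamiltonian system, i.e. a manifold $M_c$ of dimension $2n+1$ with contact form $\eta$ and a smooth function $H:M_c\to\mathbb{R}$, and let $\mathcal{E}_H$ denote the evolution vector field determined by the contact structure $\eta$ and the Hamiltonian function $H$. For a Legendrian submanifold $L\subset M_c$, the following conditions are equivalent: (i) the vector field $\mathcal{E}_H$ is tangent to $L$; (ii) the restriction of $H$ to $L$ is constant.
   Context: The contact form $\eta$ is nowhere zero and satisfies $\ker\eta\cap\ker d\eta=\{0\}$. The Reeb vector field $\mathcal{R}$ is the unique vector field with $\eta(\mathcal{R})=1$ and $i_{\mathcal{R}}d\eta=0$. The Hamiltonian vector field $X_H$ is the unique vector field on $M_c$ with $\eta(X_H)=-H$ and $\mathcal{L}_{X_H}\eta=-\mathcal{R}(H)\,\eta$. The evolution vector field $\mathcal{E}_H$ is the horizontal component of $X_H$, i.e. $\mathcal{E}_H=X_H+H\mathcal{R}$, which takes values in $\ker\eta$. Symplectic cover: $M^s=\{(p,\beta_p): p\in M_c,\ \beta_p=s\,\eta_p,\ s\in\mathbb{R}\setminus\{0\}\}$ with projection $\pi(p,\beta_p)=p$, canonical $1$-form $\omega_{(p,\beta_p)}(X)=\beta_p(\pi_*X)$ and symplectic form $\Omega=d\omega$. A submanifold $N\subset M_c$ is isotropic (resp. coisotropic) if $\pi^{-1}(N)$ is isotropic (resp. coisotropic) in $(M^s,\Omega)$, i.e. every tangent space of $\pi^{-1}(N)$ is contained in (resp. contains) its $\Omega$-orthogonal; $N$ is Legendrian if it is both isotropic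 and coisotropic.
   Formalization: The Legendrian submanifold L is assumed connected; for disconnected L, (i) does not imply (ii): with η = dz − y dx, H = z on R³ and L = {y = 0, z = 0 or 1}, E_H vanishes on L but H takes two values. *)

theory Defs
  imports "HOL-Analysis.Analysis"
begin

section \<open>Smooth maps between Euclidean spaces\<close>

text \<open>On an open set \<open>S\<close>, \<open>Ck_on k S f\<close> says that \<open>f\<close> is of class \<open>C\<^sup>k\<close>.\<close>

fun Ck_on :: "nat \<Rightarrow> 'a::euclidean_space set \<Rightarrow> ('a \<Rightarrow> 'b::euclidean_space) \<Rightarrow> bool" where
  "Ck_on 0 S f \<longleftrightarrow> continuous_on S f"
| "Ck_on (Suc k) S f \<longleftrightarrow>
     (\<forall>x\<in>S. f differentiable (at x)) \<and>
     (\<forall>v. Ck_on k S (\<lambda>x. frechet_derivative f (at x) v))"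

definition smooth_on :: "'a::euclidean_space set \<Rightarrow> ('a \<Rightarrow> 'b::euclidean_space) \<Rightarrow> bool" where
  "smooth_on S f \<longleftrightarrow> (\<forall>k. Ck_on k S f)"


section \<open>Smooth manifolds given by an atlas\<close>

text \<open>
  A chart is a pair of its domain and its coordinate map; the values of the map off the domain
  are irrelevant.  A manifold is given by an atlas \<open>A\<close> with charts in a Euclidean space
  \<open>'e\<close> (so its dimension is \<open>DIM('e)\<close>); its points are the points covered by the charts, and
  its topology is the one induced by the charts.
\<close>

type_synonym ('p, 'e) chart = "'p set \<times> ('p \<Rightarrow> 'e)"

definition carrier_of :: "('p, 'e) chart set \<Rightarrow> 'p set" where
  "carrier_of A = (\<Union>c\<in>A. fst c)"

definition chart_inv :: "('p, 'e) chart \<Rightarrow> 'e \<Rightarrow> 'p" where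
  "chart_inv c = inv_into (fst c) (snd c)"

definition transition :: "('p, 'e) chart \<Rightarrow> ('p, 'e) chart \<Rightarrow> 'e \<Rightarrow> 'e" where
  "transition c d = snd d \<circ> chart_inv c"

definition is_chart :: "('p, 'e::euclidean_space) chart \<Rightarrow> bool" where
  "is_chart c \<longleftrightarrow> inj_on (snd c) (fst c) \<and> open (snd c ` fst c)"

definition compatible :: "('p, 'e::euclidean_space) chart \<Rightarrow> ('p, 'e) chart \<Rightarrow> bool" where
  "compatible c d \<longleftrightarrow>
     open (snd c ` (fst c \<inter> fst d)) \<and> smooth_on (snd c ` (fst c \<inter> fst d)) (transition c d) \<and>
     open (snd d ` (fst c \<inter> fst d)) \<and> smooth_on (snd d ` (fst c \<inter> fst d)) (transition d c)"

definition manifold_topology :: "('p, 'e::euclidean_space) chart set \<Rightarrow> 'p topology" where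
  "manifold_topology A =
     topology (\<lambda>W. W \<subseteq> carrier_of A \<and> (\<forall>c\<in>A. open (snd c ` (W \<inter> fst c))))"

definition smooth_manifold :: "('p, 'e::euclidean_space) chart set \<Rightarrow> bool" where
  "smooth_manifold A \<longleftrightarrow>
     (\<forall>c\<in>A. is_chart c) \<and> (\<forall>c\<in>A. \<forall>d\<in>A. compatible c d) \<and>
     Hausdorff_space (manifold_topology A) \<and> second_countable (manifold_topology A)"

definition maximal_atlas :: "('p, 'e::euclidean_space) chart set \<Rightarrow> ('p, 'e) chart set" where
  "maximal_atlas A =
     {c. fst c \<subseteq> carrier_of A \<and> is_chart c \<and> (\<forall>d\<in>A. compatible c d)}"

definition chart_at :: "('p, 'e) chart set \<Rightarrow> 'p \<Rightarrow> ('p, 'e) chart" where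
  "chart_at A p = (SOME c. c \<in> A \<and> p \<in> fst c)"


section \<open>Tangent vectors, functions, vector fields, one-forms\<close>

text \<open>
  A tangent vector at \<open>p\<close> is a family of coordinate vectors, one for each chart around \<open>p\<close>,
  related by the derivatives of the transition maps.  At the charts of \<open>A\<close> that do not contain
  \<open>p\<close>, and at pairs that are not charts of \<open>A\<close>, the family is 0 by convention.
\<close>

type_synonym ('p, 'e) tvec = "('p, 'e) chart \<Rightarrow> 'e"

definition tangent_space :: "('p, 'e::euclidean_space) chart set \<Rightarrow> 'p \<Rightarrow> ('p, 'e) tvec set" where
  "tangent_space A p =
     {v. (\<forall>c. \<not> (c \<in> A \<and> p \<in> fst c) \<longrightarrow> v c = 0) \<and>
         (\<forall>c\<in>A. \<forall>d\<in>A. p \<in> fst c \<and> p \<in> fst d \<longrightarrow>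
            v d = frechet_derivative (transition c d) (at (snd c p)) (v c))}"

text \<open>The tangent vector at \<open>p\<close> with coordinates \<open>e\<close> in the chart \<open>c\<close>.\<close>

definition coord_vec ::
  "('p, 'e::euclidean_space) chart set \<Rightarrow> ('p, 'e) chart \<Rightarrow> 'p \<Rightarrow> 'e \<Rightarrow> ('p, 'e) tvec" where
  "coord_vec A c p e =
     (\<lambda>d. if d \<in> A \<and> p \<in> fst d then frechet_derivative (transition c d) (at (snd c p)) e else 0)"

text \<open>The differential at \<open>p\<close> of a map \<open>f\<close> from the manifold \<open>A\<close> to the manifold \<open>B\<close>.\<close>

definition pushforward ::
  "('p, 'e::euclidean_space) chart set \<Rightarrow> ('q, 'f::euclidean_space) chart set \<Rightarrow>
   ('p \<Rightarrow> 'q) \<Rightarrow> 'p \<Rightarrow> ('p, 'e) tvec \<Rightarrow> ('q, 'f) tvec" where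
  "pushforward A B f p v =
     (let c = chart_at A p in
      (\<lambda>d. if d \<in> B \<and> f p \<in> fst d
           then frechet_derivative (snd d \<circ> f \<circ> chart_inv c) (at (snd c p)) (v c) else 0))"

definition smooth_function ::
  "('p, 'e::euclidean_space) chart set \<Rightarrow> ('p \<Rightarrow> real) \<Rightarrow> bool" where
  "smooth_function A f \<longleftrightarrow> (\<forall>c\<in>A. smooth_on (snd c ` fst c) (f \<circ> chart_inv c))"

text \<open>The derivative \<open>v(f)\<close> of a function \<open>f\<close> along a tangent vector \<open>v\<close> at \<open>p\<close>.\<close>

definition dir_deriv ::
  "('p, 'e::euclidean_space) chart set \<Rightarrow> ('p \<Rightarrow> real) \<Rightarrow> 'p \<Rightarrow> ('p, 'e) tvec \<Rightarrow> real" where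
  "dir_deriv A f p v =
     (let c = chart_at A p in frechet_derivative (f \<circ> chart_inv c) (at (snd c p)) (v c))"

definition smooth_vector_field ::
  "('p, 'e::euclidean_space) chart set \<Rightarrow> ('p \<Rightarrow> ('p, 'e) tvec) \<Rightarrow> bool" where
  "smooth_vector_field A X \<longleftrightarrow>
     (\<forall>p\<in>carrier_of A. X p \<in> tangent_space A p) \<and>
     (\<forall>c\<in>A. smooth_on (snd c ` fst c) (\<lambda>x. X (chart_inv c x) c))"

text \<open>Covectors are extended by 0 outside the tangent space, so that they are determined by their
  values on tangent vectors.\<close>

definition cotangent_space ::
  "('p, 'e::euclidean_space) chart set \<Rightarrow> 'p \<Rightarrow> (('p, 'e) tvec \<Rightarrow> real) set" where
  "cotangent_space A p =
     {\<beta>. (\<forall>v\<in>tangent_space A p. \<forall>w\<in>tangent_space A p. \<forall>a b.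
             \<beta> (\<lambda>c. a *\<^sub>R v c + b *\<^sub>R w c) = a * \<beta> v + b * \<beta> w) \<and>
         (\<forall>v. v \<notin> tangent_space A p \<longrightarrow> \<beta> v = 0)}"

text \<open>The local representative of a one-form \<open>\<alpha>\<close> in a chart: the coefficient of \<open>\<alpha>\<close> along the
  coordinate field with constant coordinates \<open>e\<close>.\<close>

definition coord_form ::
  "('p, 'e::euclidean_space) chart set \<Rightarrow> ('p \<Rightarrow> ('p, 'e) tvec \<Rightarrow> real) \<Rightarrow>
   ('p, 'e) chart \<Rightarrow> 'e \<Rightarrow> 'e \<Rightarrow> real" where
  "coord_form A \<alpha> c x e = \<alpha> (chart_inv c x) (coord_vec A c (chart_inv c x) e)"

definition smooth_one_form ::
  "('p, 'e::euclidean_space) chart set \<Rightarrow> ('p \<Rightarrow> ('p, 'e) tvec \<Rightarrow> real) \<Rightarrow> bool" where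
  "smooth_one_form A \<alpha> \<longleftrightarrow>
     (\<forall>p\<in>carrier_of A. \<alpha> p \<in> cotangent_space A p) \<and>
     (\<forall>c\<in>A. \<forall>e. smooth_on (snd c ` fst c) (\<lambda>x. coord_form A \<alpha> c x e))"

text \<open>Exterior derivative of a one-form, computed in a chart at the point: applied to constant
  coordinate fields, \<open>d\<alpha>(V,W) = V(\<alpha>(W)) - W(\<alpha>(V)) - \<alpha>([V,W])\<close> has vanishing bracket term.\<close>

definition ext_deriv ::
  "('p, 'e::euclidean_space) chart set \<Rightarrow> ('p \<Rightarrow> ('p, 'e) tvec \<Rightarrow> real) \<Rightarrow>
   'p \<Rightarrow> ('p, 'e) tvec \<Rightarrow> ('p, 'e) tvec \<Rightarrow> real" where
  "ext_deriv A \<alpha> p v w =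
     (let c = chart_at A p; x = snd c p in
        frechet_derivative (\<lambda>y. coord_form A \<alpha> c y (w c)) (at x) (v c)
      - frechet_derivative (\<lambda>y. coord_form A \<alpha> c y (v c)) (at x) (w c))"

text \<open>
  Lie derivative of a one-form, computed in a chart at the point.  It is
  \<open>(\<L>\<^sub>X \<alpha>)(V) = X(\<alpha>(V)) - \<alpha>([X,V])\<close> for the field \<open>V\<close> with the constant coordinates of
  \<open>v\<close>, for which \<open>[X,V]\<close> has the coordinates \<open>- DX v\<close>; in index notation,
  \<open>(\<L>\<^sub>X \<alpha>)\<^sub>j = X\<^sup>i \<partial>\<^sub>i \<alpha>\<^sub>j + \<alpha>\<^sub>i \<partial>\<^sub>j X\<^sup>i\<close>.
\<close>

definition lie_deriv ::
  "('p, 'e::euclidean_space) chart set \<Rightarrow> ('p \<Rightarrow> ('p, 'e) tvec) \<Rightarrow>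
   ('p \<Rightarrow> ('p, 'e) tvec \<Rightarrow> real) \<Rightarrow> 'p \<Rightarrow> ('p, 'e) tvec \<Rightarrow> real" where
  "lie_deriv A X \<alpha> p v =
     (let c = chart_at A p; x = snd c p in
        frechet_derivative (\<lambda>y. coord_form A \<alpha> c y (v c)) (at x) (X p c)
      + coord_form A \<alpha> c x (frechet_derivative (\<lambda>y. X (chart_inv c y) c) (at x) (v c)))"


section \<open>Submanifolds and their tangent spaces\<close>

text \<open>Embedded submanifolds, by slice charts.\<close>

definition submanifold ::
  "('p, 'e::euclidean_space) chart set \<Rightarrow> nat \<Rightarrow> 'p set \<Rightarrow> bool" where
  "submanifold A k N \<longleftrightarrow>
     N \<subseteq> carrier_of A \<and>
     (\<forall>p\<in>N. \<exists>c\<in>maximal_atlas A. \<exists>S. p \<in> fst c \<and> subspace S \<and> dim S = k \<and>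
        snd c ` (fst c \<inter> N) = snd c ` fst c \<inter> S)"

definition smooth_curve ::
  "('p, 'e::euclidean_space) chart set \<Rightarrow> real set \<Rightarrow> (real \<Rightarrow> 'p) \<Rightarrow> bool" where
  "smooth_curve A I \<gamma> \<longleftrightarrow>
     \<gamma> ` I \<subseteq> carrier_of A \<and>
     (\<forall>c\<in>A. open {t\<in>I. \<gamma> t \<in> fst c} \<and> smooth_on {t\<in>I. \<gamma> t \<in> fst c} (snd c \<circ> \<gamma>))"

definition velocity ::
  "('p, 'e::euclidean_space) chart set \<Rightarrow> (real \<Rightarrow> 'p) \<Rightarrow> real \<Rightarrow> ('p, 'e) tvec" where
  "velocity A \<gamma> t =
     (\<lambda>c. if c \<in> A \<and> \<gamma> t \<in> fst c then vector_derivative (snd c \<circ> \<gamma>) (at t) else 0)"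

definition tangent_space_on ::
  "('p, 'e::euclidean_space) chart set \<Rightarrow> 'p set \<Rightarrow> 'p \<Rightarrow> ('p, 'e) tvec set" where
  "tangent_space_on A N p =
     {velocity A \<gamma> 0 | \<gamma> \<epsilon>. 0 < \<epsilon> \<and> smooth_curve A {-\<epsilon><..<\<epsilon>} \<gamma> \<and> \<gamma> 0 = p \<and>
        (\<forall>t\<in>{-\<epsilon><..<\<epsilon>}. \<gamma> t \<in> N)}"

definition tangent_to ::
  "('p, 'e::euclidean_space) chart set \<Rightarrow> ('p \<Rightarrow> ('p, 'e) tvec) \<Rightarrow> 'p set \<Rightarrow> bool" where
  "tangent_to A X N \<longleftrightarrow> (\<forall>p\<in>N. X p \<in> tangent_space_on A N p)"


section \<open>Contact Hamiltonian systems\<close>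

definition contact_form ::
  "('p, 'e::euclidean_space) chart set \<Rightarrow> ('p \<Rightarrow> ('p, 'e) tvec \<Rightarrow> real) \<Rightarrow> bool" where
  "contact_form A \<eta> \<longleftrightarrow>
     smooth_one_form A \<eta> \<and>
     (\<forall>p\<in>carrier_of A.
        (\<exists>v\<in>tangent_space A p. \<eta> p v \<noteq> 0) \<and>
        {v \<in> tangent_space A p. \<eta> p v = 0} \<inter>
        {v \<in> tangent_space A p. \<forall>w\<in>tangent_space A p. ext_deriv A \<eta> p v w = 0} = {\<lambda>_. 0})"

definition contact_hamiltonian_system ::
  "('p, 'e::euclidean_space) chart set \<Rightarrow> ('p \<Rightarrow> ('p, 'e) tvec \<Rightarrow> real) \<Rightarrow>
   ('p \<Rightarrow> real) \<Rightarrow> bool" where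
  "contact_hamiltonian_system A \<eta> H \<longleftrightarrow>
     smooth_manifold A \<and> (\<exists>n. DIM('e) = 2 * n + 1) \<and> contact_form A \<eta> \<and> smooth_function A H"

definition reeb_field ::
  "('p, 'e::euclidean_space) chart set \<Rightarrow> ('p \<Rightarrow> ('p, 'e) tvec \<Rightarrow> real) \<Rightarrow>
   ('p \<Rightarrow> ('p, 'e) tvec) \<Rightarrow> bool" where
  "reeb_field A \<eta> R \<longleftrightarrow>
     smooth_vector_field A R \<and>
     (\<forall>p\<in>carrier_of A. \<eta> p (R p) = 1 \<and>
        (\<forall>v\<in>tangent_space A p. ext_deriv A \<eta> p (R p) v = 0))"

definition hamiltonian_field ::
  "('p, 'e::euclidean_space) chart set \<Rightarrow> ('p \<Rightarrow> ('p, 'e) tvec \<Rightarrow> real) \<Rightarrow>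
   ('p \<Rightarrow> real) \<Rightarrow> ('p \<Rightarrow> ('p, 'e) tvec) \<Rightarrow> ('p \<Rightarrow> ('p, 'e) tvec) \<Rightarrow> bool" where
  "hamiltonian_field A \<eta> H R X \<longleftrightarrow>
     smooth_vector_field A X \<and>
     (\<forall>p\<in>carrier_of A. \<eta> p (X p) = - H p \<and>
        (\<forall>v\<in>tangent_space A p. lie_deriv A X \<eta> p v = - dir_deriv A H p (R p) * \<eta> p v))"

definition evolution_field ::
  "('p \<Rightarrow> real) \<Rightarrow> ('p \<Rightarrow> ('p, 'e::euclidean_space) tvec) \<Rightarrow> ('p \<Rightarrow> ('p, 'e) tvec) \<Rightarrow>
   'p \<Rightarrow> ('p, 'e) tvec" where
  "evolution_field H R X p = (\<lambda>c. X p c + H p *\<^sub>R R p c)"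


section \<open>The symplectic cover and Legendrian submanifolds\<close>

text \<open>
  The points of the cover are pairs of a point and a covector at it.  The smooth structure is
  that of the submanifold of the cotangent bundle parametrised by \<open>(p, s) \<mapsto> (p, s \<eta>\<^sub>p)\<close>: a chart
  of the base lifts to the chart whose last coordinate is the factor \<open>s\<close>.
\<close>

type_synonym ('p, 'e) covector_point = "'p \<times> (('p, 'e) tvec \<Rightarrow> real)"

definition cover_points ::
  "('p, 'e::euclidean_space) chart set \<Rightarrow> ('p \<Rightarrow> ('p, 'e) tvec \<Rightarrow> real) \<Rightarrow>
   ('p, 'e) covector_point set" where
  "cover_points A \<eta> = {(p, \<lambda>v. s * \<eta> p v) | p s. p \<in> carrier_of A \<and> s \<noteq> 0}"

definition cover_chart ::
  "('p, 'e::euclidean_space) chart set \<Rightarrow> ('p \<Rightarrow> ('p, 'e) tvec \<Rightarrow> real) \<Rightarrow>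
   ('p, 'e) chart \<Rightarrow> (('p, 'e) covector_point, 'e \<times> real) chart" where
  "cover_chart A \<eta> c =
     ({q \<in> cover_points A \<eta>. fst q \<in> fst c},
      \<lambda>(p, \<beta>). (snd c p, THE s. \<beta> = (\<lambda>v. s * \<eta> p v)))"

definition cover_atlas ::
  "('p, 'e::euclidean_space) chart set \<Rightarrow> ('p \<Rightarrow> ('p, 'e) tvec \<Rightarrow> real) \<Rightarrow>
   (('p, 'e) covector_point, 'e \<times> real) chart set" where
  "cover_atlas A \<eta> = cover_chart A \<eta> ` A"

text \<open>The canonical one-form \<open>\<omega>\<close> of the cover (the projection to the base is \<open>fst\<close>) and
  \<open>\<Omega> = d\<omega>\<close>.\<close>

definition cover_one_form ::
  "('p, 'e::euclidean_space) chart set \<Rightarrow> ('p \<Rightarrow> ('p, 'e) tvec \<Rightarrow> real) \<Rightarrow>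
   ('p, 'e) covector_point \<Rightarrow> (('p, 'e) covector_point, 'e \<times> real) tvec \<Rightarrow> real" where
  "cover_one_form A \<eta> q X = snd q (pushforward (cover_atlas A \<eta>) A fst q X)"

definition cover_symplectic ::
  "('p, 'e::euclidean_space) chart set \<Rightarrow> ('p \<Rightarrow> ('p, 'e) tvec \<Rightarrow> real) \<Rightarrow>
   ('p, 'e) covector_point \<Rightarrow> (('p, 'e) covector_point, 'e \<times> real) tvec \<Rightarrow>
   (('p, 'e) covector_point, 'e \<times> real) tvec \<Rightarrow> real" where
  "cover_symplectic A \<eta> = ext_deriv (cover_atlas A \<eta>) (cover_one_form A \<eta>)"

definition cover_preimage ::
  "('p, 'e::euclidean_space) chart set \<Rightarrow> ('p \<Rightarrow> ('p, 'e) tvec \<Rightarrow> real) \<Rightarrow>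
   'p set \<Rightarrow> ('p, 'e) covector_point set" where
  "cover_preimage A \<eta> N = {q \<in> cover_points A \<eta>. fst q \<in> N}"

definition orthogonal_space ::
  "('p, 'e::euclidean_space) chart set \<Rightarrow> ('p \<Rightarrow> ('p, 'e) tvec \<Rightarrow> ('p, 'e) tvec \<Rightarrow> real) \<Rightarrow>
   'p \<Rightarrow> ('p, 'e) tvec set \<Rightarrow> ('p, 'e) tvec set" where
  "orthogonal_space A \<Omega> p T = {v \<in> tangent_space A p. \<forall>w\<in>T. \<Omega> p v w = 0}"

definition isotropic ::
  "('p, 'e::euclidean_space) chart set \<Rightarrow> ('p \<Rightarrow> ('p, 'e) tvec \<Rightarrow> real) \<Rightarrow> 'p set \<Rightarrow> bool" where
  "isotropic A \<eta> N \<longleftrightarrow>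
     (let B = cover_atlas A \<eta>; P = cover_preimage A \<eta> N in
      \<forall>q\<in>P. tangent_space_on B P q \<subseteq>
        orthogonal_space B (cover_symplectic A \<eta>) q (tangent_space_on B P q))"

definition coisotropic ::
  "('p, 'e::euclidean_space) chart set \<Rightarrow> ('p \<Rightarrow> ('p, 'e) tvec \<Rightarrow> real) \<Rightarrow> 'p set \<Rightarrow> bool" where
  "coisotropic A \<eta> N \<longleftrightarrow>
     (let B = cover_atlas A \<eta>; P = cover_preimage A \<eta> N in
      \<forall>q\<in>P. orthogonal_space B (cover_symplectic A \<eta>) q (tangent_space_on B P q) \<subseteq>
        tangent_space_on B P q)"

definition legendrian_submanifold ::
  "('p, 'e::euclidean_space) chart set \<Rightarrow> ('p \<Rightarrow> ('p, 'e) tvec \<Rightarrow> real) \<Rightarrow> 'p set \<Rightarrow> bool" where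
  "legendrian_submanifold A \<eta> L \<longleftrightarrow>
     (\<exists>k. submanifold A k L) \<and> isotropic A \<eta> L \<and> coisotropic A \<eta> L"

end

(* With E = X_H + H R, comparing the derivative of eta(X_H) = -H with the equation for the Lie
   derivative L_{X_H} eta gives eta(E) = 0 and d eta(E, v) = dH(v) - R(H) eta(v).  In the chart with
   last coordinate s, the form on the cover is
     Omega((v, a), (w, b)) = s d eta(v, w) + a eta(w) - b eta(v),
   and the tangent spaces of the preimage of L are T L x R.  Hence isotropy says that eta and
   d eta vanish on T L, so that d eta(E, v) = dH(v) for v in T L.  If E is tangent to L, then dH
   vanishes on T L and H is constant on the connected L.  Conversely, if H is constant on L, then
   (E, 0) is Omega-orthogonal to the tangent spaces of the preimage, and coisotropy puts E in T L. *)

theory Submission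
  imports Defs
begin

text \<open>The operators \<open>ext_deriv\<close>, \<open>lie_deriv\<close> and
  \<open>dir_deriv\<close> are evaluated in a chart picked by \<open>chart_at\<close>, and the chart
  picked on the cover need not lie over the one picked on the base. The formula for \<Omega>
  therefore rests on the chart independence of \<open>ext_deriv\<close>, and this is where the
  symmetry of second derivatives enters. Tangent spaces of subsets are sets of velocities of curves,
  with no linear structure at hand. So T L x R is identified with the tangent space of the preimage
  by projecting curves and by lifting them with an affine factor s + t \<sigma>. The free slope
  \<sigma> is what allows isotropy to be tested on (v, 0) and (v, 1), which separates \<eta>(v) from
  d\<eta>. The identity for d\<eta>(E, v) is Cartan's formula i_X d\<eta> = L_X \<eta> -
  d(\<eta>(X)) with \<eta>(X) = -H. The summand H R cancels \<eta>(X) and, since i_R d\<eta> = 0,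
  leaves i_X d\<eta> unchanged. That H is locally constant on L is seen along straight segments in a
  slice chart.\<close>

section \<open>Calculus\<close>

lemma second_difference_mean_value:
  fixes f :: "'a::real_normed_vector \<Rightarrow> real"
  assumes f: "\<And>y. y \<in> U \<Longrightarrow> (f has_derivative f' y) (at y)"
    and fa: "\<And>y. y \<in> U \<Longrightarrow> ((\<lambda>y. f' y a) has_derivative fa y) (at y)"
    and U: "\<And>s t. \<lbrakk>0 \<le> s; s \<le> h; 0 \<le> t; t \<le> h\<rbrakk> \<Longrightarrow> x + s *\<^sub>R a + t *\<^sub>R b \<in> U"
    and h: "0 < h"
  obtains s t where "0 < s" "s < h" "0 < t" "t < h"
    "f (x + h *\<^sub>R a + h *\<^sub>R b) - f (x + h *\<^sub>R a) - (f (x + h *\<^sub>R b) - f x)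
      = h * h * fa (x + s *\<^sub>R a + t *\<^sub>R b) b"
proof -
  \<comment> \<open>The mean value theorem is applied along \<open>a\<close> to the increment
    \<open>u\<close> in direction \<open>b\<close>, and then along \<open>b\<close> to the
    derivative of \<open>f\<close> in direction \<open>a\<close>.\<close>
  define u where "u s = f (x + s *\<^sub>R a + h *\<^sub>R b) - f (x + s *\<^sub>R a)" for s
  define u' where "u' s = f' (x + s *\<^sub>R a + h *\<^sub>R b) a - f' (x + s *\<^sub>R a) a" for s
  have D: "((\<lambda>s. f (x + s *\<^sub>R a + t *\<^sub>R b)) has_field_derivative f' (x + s *\<^sub>R a + t *\<^sub>R b) a) (at s)"
    if "0 \<le> s" "s \<le> h" "0 \<le> t" "t \<le> h" for s t
  proof -
    have 1: "((\<lambda>s. x + s *\<^sub>R a + t *\<^sub>R b) has_derivative (\<lambda>k. k *\<^sub>R a)) (at s)"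
      by (auto intro!: derivative_eq_intros)
    have 2: "((\<lambda>s. f (x + s *\<^sub>R a + t *\<^sub>R b)) has_derivative (\<lambda>k. f' (x + s *\<^sub>R a + t *\<^sub>R b) (k *\<^sub>R a))) (at s)"
      by (rule has_derivative_compose[OF 1 f[OF U[OF that]]])
    have "linear (f' (x + s *\<^sub>R a + t *\<^sub>R b))"
      by (rule has_derivative_linear[OF f[OF U[OF that]]])
    then have "(\<lambda>k. f' (x + s *\<^sub>R a + t *\<^sub>R b) (k *\<^sub>R a)) = (*) (f' (x + s *\<^sub>R a + t *\<^sub>R b) a)"
      by (auto simp: linear_cmul)
    then show ?thesis using 2 by (simp add: has_field_derivative_def)
  qed
  have "DERIV u s :> u' s" if "0 \<le> s" "s \<le> h" for s
    using DERIV_diff[OF D[of s h] D[of s 0]] that h by (simp add: u_def[abs_def] u'_def)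
  from MVT2[OF h this] obtain s where s: "0 < s" "s < h" and us: "u h - u 0 = h * u' s" by auto
  have "((\<lambda>t. f' (x + s *\<^sub>R a + t *\<^sub>R b) a) has_field_derivative fa (x + s *\<^sub>R a + t *\<^sub>R b) b) (at t)"
    if "0 \<le> t" "t \<le> h" for t
  proof -
    have xU: "x + s *\<^sub>R a + t *\<^sub>R b \<in> U" using U s that by simp
    have 1: "((\<lambda>t. x + s *\<^sub>R a + t *\<^sub>R b) has_derivative (\<lambda>k. k *\<^sub>R b)) (at t)"
      by (auto intro!: derivative_eq_intros)
    have 2: "((\<lambda>t. f' (x + s *\<^sub>R a + t *\<^sub>R b) a) has_derivative (\<lambda>k. fa (x + s *\<^sub>R a + t *\<^sub>R b) (k *\<^sub>R b))) (at t)"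
      by (rule has_derivative_compose[OF 1 fa[OF xU]])
    have "linear (fa (x + s *\<^sub>R a + t *\<^sub>R b))"
      by (rule has_derivative_linear[OF fa[OF xU]])
    then have "(\<lambda>k. fa (x + s *\<^sub>R a + t *\<^sub>R b) (k *\<^sub>R b)) = (*) (fa (x + s *\<^sub>R a + t *\<^sub>R b) b)"
      by (auto simp: linear_cmul)
    then show ?thesis using 2 by (simp add: has_field_derivative_def)
  qed
  from MVT2[OF h this] obtain t where t: "0 < t" "t < h"
    and "f' (x + s *\<^sub>R a + h *\<^sub>R b) a - f' (x + s *\<^sub>R a) a = h * fa (x + s *\<^sub>R a + t *\<^sub>R b) b"
    by auto
  then have "u h - u 0 = h * h * fa (x + s *\<^sub>R a + t *\<^sub>R b) b" using us by (simp add: u'_def)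
  then show ?thesis using that[OF s t] by (simp add: u_def)
qed

text \<open>The second difference of \<open>f\<close> over a small parallelogram does not depend on
  the order of \<open>a\<close> and \<open>b\<close>. So the two mixed derivatives take a common
  value at two points close to \<open>x\<close>, and continuity carries this to
  \<open>x\<close>.\<close>

lemma mixed_derivatives_symmetric_real:
  fixes f :: "'a::real_normed_vector \<Rightarrow> real"
  assumes U: "open U" "x \<in> U"
    and f: "\<And>y. y \<in> U \<Longrightarrow> (f has_derivative f' y) (at y)"
    and fa: "\<And>y. y \<in> U \<Longrightarrow> ((\<lambda>y. f' y a) has_derivative fa y) (at y)"
    and fb: "\<And>y. y \<in> U \<Longrightarrow> ((\<lambda>y. f' y b) has_derivative fb y) (at y)"
    and ca: "continuous_on U (\<lambda>y. fa y b)" and cb: "continuous_on U (\<lambda>y. fb y a)"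
  shows "fa x b = fb x a"
proof (rule ccontr)
  assume ne: "fa x b \<noteq> fb x a"
  define e where "e = \<bar>fa x b - fb x a\<bar> / 2"
  have e: "e > 0" using ne by (simp add: e_def)
  have "isCont (\<lambda>y. fa y b) x" "isCont (\<lambda>y. fb y a) x"
    using ca cb U continuous_on_eq_continuous_at by blast+
  then obtain d1 d2 where d: "d1 > 0" "d2 > 0"
      "\<And>y. dist y x < d1 \<Longrightarrow> dist (fa y b) (fa x b) < e"
      "\<And>y. dist y x < d2 \<Longrightarrow> dist (fb y a) (fb x a) < e"
    using e unfolding continuous_at_eps_delta by metis
  obtain d3 where d3: "d3 > 0" "ball x d3 \<subseteq> U" using U openE by blast
  define r where "r = min d3 (min d1 d2)"
  have r: "r > 0" using d d3 by (simp add: r_def)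
  \<comment> \<open>With this side the whole parallelogram lies within \<open>r\<close> of
    \<open>x\<close>; the summand 1 keeps the denominator positive when \<open>a\<close> and
    \<open>b\<close> are both 0.\<close>
  define h where "h = r / (norm a + norm b + 1)"
  have np: "norm a + norm b + 1 > 0" by (smt (verit) norm_ge_zero)
  have h: "h > 0" using r np by (simp add: h_def)
  have near: "dist (x + s *\<^sub>R a + t *\<^sub>R b) x < r" if "0 \<le> s" "s \<le> h" "0 \<le> t" "t \<le> h" for s t
  proof -
    have "dist (x + s *\<^sub>R a + t *\<^sub>R b) x = norm (s *\<^sub>R a + t *\<^sub>R b)" by (simp add: dist_norm add.assoc)
    also have "\<dots> \<le> s * norm a + t * norm b" using norm_triangle_ineq[of "s *\<^sub>R a" "t *\<^sub>R b"] that by simp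
    also have "\<dots> \<le> h * norm a + h * norm b" using that by (intro add_mono mult_right_mono) auto
    also have "\<dots> < h * (norm a + norm b + 1)" using h by (simp add: algebra_simps)
    also have "\<dots> = r" using np by (simp add: h_def)
    finally show ?thesis .
  qed
  have inU: "x + s *\<^sub>R a + t *\<^sub>R b \<in> U" if "0 \<le> s" "s \<le> h" "0 \<le> t" "t \<le> h" for s t
    using near[OF that] d3 by (auto simp: r_def dist_commute)
  obtain s t where st: "0 < s" "s < h" "0 < t" "t < h"
    "f (x + h *\<^sub>R a + h *\<^sub>R b) - f (x + h *\<^sub>R a) - (f (x + h *\<^sub>R b) - f x) = h * h * fa (x + s *\<^sub>R a + t *\<^sub>R b) b"
    using second_difference_mean_value[OF f fa inU h] by blast
  have inU': "x + s *\<^sub>R b + t *\<^sub>R a \<in> U" if "0 \<le> s" "s \<le> h" "0 \<le> t" "t \<le> h" for s t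
    using inU[of t s] that by (simp add: ac_simps)
  obtain s' t' where st': "0 < s'" "s' < h" "0 < t'" "t' < h"
    "f (x + h *\<^sub>R b + h *\<^sub>R a) - f (x + h *\<^sub>R b) - (f (x + h *\<^sub>R a) - f x) = h * h * fb (x + s' *\<^sub>R b + t' *\<^sub>R a) a"
    using second_difference_mean_value[OF f fb inU' h] by blast
  have "h * h * fa (x + s *\<^sub>R a + t *\<^sub>R b) b = h * h * fb (x + t' *\<^sub>R a + s' *\<^sub>R b) a"
    using st(5) st'(5) by (simp only: add.assoc add.commute[of "_ *\<^sub>R b" "_ *\<^sub>R a"])
  then have eq: "fa (x + s *\<^sub>R a + t *\<^sub>R b) b = fb (x + t' *\<^sub>R a + s' *\<^sub>R b) a" using h by simp
  have "dist (fa (x + s *\<^sub>R a + t *\<^sub>R b) b) (fa x b) < e"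
    "dist (fb (x + t' *\<^sub>R a + s' *\<^sub>R b) a) (fb x a) < e"
    using near[of s t] near[of t' s'] st st' by (auto intro!: d simp: r_def)
  then have "\<bar>fa x b - fb x a\<bar> < 2 * e" using eq unfolding dist_real_def by linarith
  then show False by (simp add: e_def)
qed

lemma mixed_derivatives_symmetric:
  fixes f :: "'a::real_normed_vector \<Rightarrow> 'b::euclidean_space"
  assumes U: "open U" "x \<in> U"
    and f: "\<And>y. y \<in> U \<Longrightarrow> (f has_derivative f' y) (at y)"
    and fa: "\<And>y. y \<in> U \<Longrightarrow> ((\<lambda>y. f' y a) has_derivative fa y) (at y)"
    and fb: "\<And>y. y \<in> U \<Longrightarrow> ((\<lambda>y. f' y b) has_derivative fb y) (at y)"
    and ca: "continuous_on U (\<lambda>y. fa y b)" and cb: "continuous_on U (\<lambda>y. fb y a)"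
  shows "fa x b = fb x a"
proof (rule euclidean_eqI)
  fix i :: 'b assume "i \<in> Basis"
  show "fa x b \<bullet> i = fb x a \<bullet> i"
    by (rule mixed_derivatives_symmetric_real[OF U has_derivative_inner_left[OF f]
          has_derivative_inner_left[OF fa] has_derivative_inner_left[OF fb]
          continuous_on_inner[OF ca continuous_on_const] continuous_on_inner[OF cb continuous_on_const]])
qed

section \<open>Operations on maps of class C^k\<close>

lemma Ck_on_Suc_differentiable: "Ck_on (Suc k) S f \<Longrightarrow> x \<in> S \<Longrightarrow> f differentiable at x"
  by simp

lemma smooth_on_differentiable: "smooth_on S f \<Longrightarrow> x \<in> S \<Longrightarrow> f differentiable at x"
  unfolding smooth_on_def using Ck_on_Suc_differentiable by blast

lemma smooth_on_derivative: "smooth_on S f \<Longrightarrow> smooth_on S (\<lambda>x. frechet_derivative f (at x) v)"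
  unfolding smooth_on_def by (metis Ck_on.simps(2))

lemma smooth_on_continuous: "smooth_on S f \<Longrightarrow> continuous_on S f"
  unfolding smooth_on_def by (metis Ck_on.simps(1))

lemma smooth_on_second_derivative_symmetric:
  assumes f: "smooth_on U f" and U: "open U" "x \<in> U"
  shows "frechet_derivative (\<lambda>y. frechet_derivative f (at y) a) (at x) b
    = frechet_derivative (\<lambda>y. frechet_derivative f (at y) b) (at x) a"
  by (rule mixed_derivatives_symmetric[OF U, where f = f and f' = "\<lambda>y. frechet_derivative f (at y)"])
    (simp_all add: smooth_on_differentiable[of U] smooth_on_derivative smooth_on_continuous f
      flip: frechet_derivative_works)

text \<open>\<open>Ck_on\<close> uses derivatives in the full space; openness of \<open>S\<close>
  makes them depend only on the values on \<open>S\<close>.\<close>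

lemma Ck_on_cong:
  assumes "open S" "\<And>x. x \<in> S \<Longrightarrow> f x = g x"
  shows "Ck_on k S f \<longleftrightarrow> Ck_on k S g"
  using assms(2)
proof (induction k arbitrary: f g)
  case 0
  then show ?case by (auto cong: continuous_on_cong)
next
  case (Suc k)
  have imp: "Ck_on (Suc k) S g'" if f': "Ck_on (Suc k) S f'" and eq: "\<And>x. x \<in> S \<Longrightarrow> f' x = g' x" for f' g' :: "'a \<Rightarrow> 'b"
  proof -
    have d: "g' differentiable at x" if "x \<in> S" for x
      using f' that has_derivative_transform_within_open[where f = f' and g = g', OF _ assms(1) that eq]
      unfolding differentiable_def Ck_on.simps by blast
    have D: "frechet_derivative f' (at x) = frechet_derivative g' (at x)" if "x \<in> S" for x
      using frechet_derivative_transform_within_open[OF _ assms(1) that eq] f' that by simp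
    have "Ck_on k S (\<lambda>x. frechet_derivative g' (at x) v)" for v
      using f' by (subst Suc.IH[symmetric, of "\<lambda>x. frechet_derivative f' (at x) v"]) (simp_all add: D)
    with d show ?thesis by simp
  qed
  show ?case by (rule iffI; erule imp; simp add: Suc.prems)
qed

lemma smooth_on_cong:
  "open S \<Longrightarrow> (\<And>x. x \<in> S \<Longrightarrow> f x = g x) \<Longrightarrow> smooth_on S f \<longleftrightarrow> smooth_on S g"
  unfolding smooth_on_def using Ck_on_cong by blast

lemma Ck_on_subset: "Ck_on k S f \<Longrightarrow> T \<subseteq> S \<Longrightarrow> Ck_on k T f"
  by (induction k arbitrary: f) (auto intro: continuous_on_subset)

lemma smooth_on_subset: "smooth_on S f \<Longrightarrow> T \<subseteq> S \<Longrightarrow> smooth_on T f"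
  unfolding smooth_on_def using Ck_on_subset by blast

text \<open>Linear images, pairs and restrictions to a line suffice for the curves below. The
  derivative of each is an operation of the same shape on derivatives, so the induction on
  \<open>k\<close> closes without a general chain rule for C^k maps.\<close>

lemma Ck_on_linear_image:
  assumes S: "open S" and l: "bounded_linear l"
  shows "Ck_on k S f \<Longrightarrow> Ck_on k S (\<lambda>x. l (f x))"
proof (induction k arbitrary: f)
  case 0
  then show ?case using l by (simp add: bounded_linear.continuous_on)
next
  case (Suc k)
  have D: "((\<lambda>x. l (f x)) has_derivative (\<lambda>v. l (frechet_derivative f (at x) v))) (at x)" if "x \<in> S" for x
    using Suc.prems that by (intro bounded_linear.has_derivative[OF l]) (simp flip: frechet_derivative_works)
  have "Ck_on k S (\<lambda>x. frechet_derivative (\<lambda>x. l (f x)) (at x) v)" for v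
    using Suc.IH[of "\<lambda>x. frechet_derivative f (at x) v"] Suc.prems
    by (subst Ck_on_cong[OF S, where g = "\<lambda>x. l (frechet_derivative f (at x) v)"])
      (auto simp flip: frechet_derivative_at[OF D])
  then show ?case using D by (auto simp: differentiable_def)
qed

lemma smooth_on_linear_image:
  "open S \<Longrightarrow> bounded_linear l \<Longrightarrow> smooth_on S f \<Longrightarrow> smooth_on S (\<lambda>x. l (f x))"
  unfolding smooth_on_def using Ck_on_linear_image by blast

lemma Ck_on_Pair:
  assumes S: "open S"
  shows "Ck_on k S f \<Longrightarrow> Ck_on k S g \<Longrightarrow> Ck_on k S (\<lambda>x. (f x, g x))"
proof (induction k arbitrary: f g)
  case 0
  then show ?case by (simp add: continuous_on_Pair)
next
  case (Suc k)
  have D: "((\<lambda>x. (f x, g x)) has_derivative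
      (\<lambda>v. (frechet_derivative f (at x) v, frechet_derivative g (at x) v))) (at x)" if "x \<in> S" for x
    using Suc.prems that by (intro has_derivative_Pair) (simp_all flip: frechet_derivative_works)
  have "Ck_on k S (\<lambda>x. frechet_derivative (\<lambda>x. (f x, g x)) (at x) v)" for v
    using Suc.IH[of "\<lambda>x. frechet_derivative f (at x) v" "\<lambda>x. frechet_derivative g (at x) v"]
      Suc.prems
    by (subst Ck_on_cong[OF S, where g = "\<lambda>x. (frechet_derivative f (at x) v, frechet_derivative g (at x) v)"])
      (auto simp flip: frechet_derivative_at[OF D])
  then show ?case using D by (auto simp: differentiable_def)
qed

lemma smooth_on_Pair:
  "open S \<Longrightarrow> smooth_on S f \<Longrightarrow> smooth_on S g \<Longrightarrow> smooth_on S (\<lambda>x. (f x, g x))"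
  unfolding smooth_on_def using Ck_on_Pair by blast

lemma Ck_on_const: "Ck_on k S (\<lambda>x. c)"
  by (induction k arbitrary: c) auto

lemma Ck_on_compose_line:
  fixes f :: "'a::euclidean_space \<Rightarrow> 'b::euclidean_space" and T :: "real set"
  assumes T: "open T" and TS: "\<And>t. t \<in> T \<Longrightarrow> x + t *\<^sub>R v \<in> S"
  shows "Ck_on k S f \<Longrightarrow> Ck_on k T (\<lambda>t. f (x + t *\<^sub>R v))"
proof (induction k arbitrary: f)
  case 0
  have "continuous_on T (\<lambda>t. x + t *\<^sub>R v)" by (intro continuous_intros)
  with 0 TS show ?case using continuous_on_compose2[of S f T "\<lambda>t. x + t *\<^sub>R v"] by auto
next
  case (Suc k)
  have D: "((\<lambda>t. f (x + t *\<^sub>R v)) has_derivative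
      (\<lambda>h. frechet_derivative f (at (x + t *\<^sub>R v)) (h *\<^sub>R v))) (at t)" if "t \<in> T" for t
  proof (rule has_derivative_compose[where g = f])
    show "((\<lambda>t. x + t *\<^sub>R v) has_derivative (\<lambda>h. h *\<^sub>R v)) (at t)"
      by (auto intro!: derivative_eq_intros)
  qed (use Suc.prems TS that in \<open>simp flip: frechet_derivative_works\<close>)
  \<comment> \<open>The direction \<open>h *\<^sub>R v\<close> is constant, so the derivative is
    again a map of class C^k restricted to the same line.\<close>
  have "Ck_on k T (\<lambda>t. frechet_derivative (\<lambda>t. f (x + t *\<^sub>R v)) (at t) h)" for h
    using Suc.IH[of "\<lambda>y. frechet_derivative f (at y) (h *\<^sub>R v)"] Suc.prems
    by (subst Ck_on_cong[OF T, where g = "\<lambda>t. frechet_derivative f (at (x + t *\<^sub>R v)) (h *\<^sub>R v)"])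
      (auto simp flip: frechet_derivative_at[OF D])
  then show ?case using D by (auto simp: differentiable_def)
qed

lemma smooth_on_compose_line:
  fixes f :: "'a::euclidean_space \<Rightarrow> 'b::euclidean_space" and T :: "real set"
  assumes "open T" "\<And>t. t \<in> T \<Longrightarrow> x + t *\<^sub>R v \<in> S" "smooth_on S f"
  shows "smooth_on T (\<lambda>t. f (x + t *\<^sub>R v))"
  using assms Ck_on_compose_line unfolding smooth_on_def by metis

lemma smooth_on_id: "smooth_on S (\<lambda>x. x)"
proof -
  have "Ck_on k S (\<lambda>x. x)" for k by (cases k) (auto intro: Ck_on_const)
  then show ?thesis by (simp add: smooth_on_def)
qed

lemma smooth_on_affine: "smooth_on (T::real set) (\<lambda>t. x + t *\<^sub>R (v::'a::euclidean_space))"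
proof -
  have "smooth_on UNIV (\<lambda>t. x + t *\<^sub>R v)"
    by (rule smooth_on_compose_line[where f = "\<lambda>x. x" and S = UNIV]) (auto intro: smooth_on_id)
  then show ?thesis by (rule smooth_on_subset) simp
qed

section \<open>Differentiating a family of linear forms\<close>

lemma linear_sum_Basis:
  fixes h :: "'e::euclidean_space \<Rightarrow> 'b::real_vector"
  assumes "linear h"
  shows "h e = (\<Sum>b\<in>Basis. (e \<bullet> b) *\<^sub>R h b)"
proof -
  have "h e = h (\<Sum>b\<in>Basis. (e \<bullet> b) *\<^sub>R b)" by (simp add: euclidean_representation)
  also have "\<dots> = (\<Sum>b\<in>Basis. (e \<bullet> b) *\<^sub>R h b)" using assms by (simp add: linear_sum linear_cmul)
  finally show ?thesis .
qed

text \<open>A product rule for evaluating a moving linear form on a moving vector. The form is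
  differentiable only for each fixed vector, so it is expanded in the basis, which leaves a finite
  sum of ordinary products.\<close>

lemma has_derivative_pointwise_linear:
  fixes h :: "'a::real_normed_vector \<Rightarrow> 'e::euclidean_space \<Rightarrow> real"
  assumes U: "open U" "x \<in> U" and lin: "\<And>y. y \<in> U \<Longrightarrow> linear (h y)"
    and h: "\<And>e. (\<lambda>y. h y e) differentiable at x" and g: "(g has_derivative g') (at x)"
  shows "((\<lambda>y. h y (g y)) has_derivative
    (\<lambda>k. frechet_derivative (\<lambda>y. h y (g x)) (at x) k + h x (g' k))) (at x)"
proof -
  let ?d = "\<lambda>b. frechet_derivative (\<lambda>y. h y b) (at x)"
  have hd: "((\<lambda>y. h y b) has_derivative ?d b) (at x)" for b
    using h by (simp flip: frechet_derivative_works)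
  have "((\<lambda>y. \<Sum>b\<in>Basis. (g x \<bullet> b) *\<^sub>R h y b) has_derivative (\<lambda>k. \<Sum>b\<in>Basis. (g x \<bullet> b) *\<^sub>R ?d b k)) (at x)"
    by (intro has_derivative_sum has_derivative_scaleR_right hd)
  then have "((\<lambda>y. h y (g x)) has_derivative (\<lambda>k. \<Sum>b\<in>Basis. (g x \<bullet> b) *\<^sub>R ?d b k)) (at x)"
    by (rule has_derivative_transform_within_open[OF _ U]) (metis lin linear_sum_Basis)
  then have e1: "frechet_derivative (\<lambda>y. h y (g x)) (at x) = (\<lambda>k. \<Sum>b\<in>Basis. (g x \<bullet> b) *\<^sub>R ?d b k)"
    by (rule frechet_derivative_at[symmetric])
  have e2: "h x (g' k) = (\<Sum>b\<in>Basis. (g' k \<bullet> b) *\<^sub>R h x b)" for k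
    using linear_sum_Basis[OF lin[OF U(2)]] .
  have "((\<lambda>y. \<Sum>b\<in>Basis. (g y \<bullet> b) *\<^sub>R h y b) has_derivative
      (\<lambda>k. \<Sum>b\<in>Basis. (g x \<bullet> b) *\<^sub>R ?d b k + (g' k \<bullet> b) *\<^sub>R h x b)) (at x)"
    by (intro has_derivative_sum has_derivative_scaleR has_derivative_inner_left g hd)
  then have "((\<lambda>y. \<Sum>b\<in>Basis. (g y \<bullet> b) *\<^sub>R h y b) has_derivative
      (\<lambda>k. frechet_derivative (\<lambda>y. h y (g x)) (at x) k + h x (g' k))) (at x)"
    by (simp only: e1 e2 sum.distrib)
  then show ?thesis
    by (rule has_derivative_transform_within_open[OF _ U]) (metis lin linear_sum_Basis)
qed

section \<open>Atlases and one-forms\<close>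

abbreviation tangent_transition ::
  "('p, 'e::euclidean_space) chart \<Rightarrow> ('p, 'e) chart \<Rightarrow> 'p \<Rightarrow> 'e \<Rightarrow> 'e" where
  "tangent_transition c d p \<equiv> frechet_derivative (transition c d) (at (snd c p))"

lemma chart_inv_snd: "is_chart c \<Longrightarrow> p \<in> fst c \<Longrightarrow> chart_inv c (snd c p) = p"
  by (simp add: is_chart_def chart_inv_def)

lemma chart_inv_in: "x \<in> snd c ` fst c \<Longrightarrow> chart_inv c x \<in> fst c"
  unfolding chart_inv_def by (rule inv_into_into)

lemma snd_chart_inv: "x \<in> snd c ` fst c \<Longrightarrow> snd c (chart_inv c x) = x"
  unfolding chart_inv_def by (rule f_inv_into_f)

lemma transition_snd: "is_chart c \<Longrightarrow> p \<in> fst c \<Longrightarrow> transition c d (snd c p) = snd d p"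
  by (simp add: transition_def chart_inv_snd)

text \<open>Tangent vectors, velocities and coordinate vectors involve only first derivatives of
  transition maps. This weaker level is shared by the base and the cover; the smooth level is
  reached only by the base, where second derivatives occur.\<close>

locale differentiable_atlas =
  fixes A :: "('p, 'e::euclidean_space) chart set"
  assumes chart: "c \<in> A \<Longrightarrow> is_chart c"
    and open_overlap: "c \<in> A \<Longrightarrow> d \<in> A \<Longrightarrow> open (snd c ` (fst c \<inter> fst d))"
    and transition_differentiable: "c \<in> A \<Longrightarrow> d \<in> A \<Longrightarrow> p \<in> fst c \<Longrightarrow> p \<in> fst d \<Longrightarrow>
      transition c d differentiable at (snd c p)"
begin

lemma open_image: "c \<in> A \<Longrightarrow> open (snd c ` fst c)"
  using chart is_chart_def by blast

lemma chart_at: "p \<in> carrier_of A \<Longrightarrow> chart_at A p \<in> A \<and> p \<in> fst (chart_at A p)"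
  unfolding chart_at_def carrier_of_def by (rule someI_ex) auto

lemma transition_has_derivative:
  "c \<in> A \<Longrightarrow> d \<in> A \<Longrightarrow> p \<in> fst c \<Longrightarrow> p \<in> fst d \<Longrightarrow>
    (transition c d has_derivative tangent_transition c d p) (at (snd c p))"
  using transition_differentiable frechet_derivative_works by blast

lemma linear_tangent_transition:
  "c \<in> A \<Longrightarrow> d \<in> A \<Longrightarrow> p \<in> fst c \<Longrightarrow> p \<in> fst d \<Longrightarrow> linear (tangent_transition c d p)"
  using transition_differentiable linear_frechet_derivative by blast

lemma tangent_transition_self:
  assumes "c \<in> A" "p \<in> fst c"
  shows "tangent_transition c c p = (\<lambda>e. e)"
proof -
  have "((\<lambda>x. x) has_derivative (\<lambda>e. e)) (at (snd c p))" by (rule has_derivative_ident)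
  then have "(transition c c has_derivative (\<lambda>e. e)) (at (snd c p))"
    by (rule has_derivative_transform_within_open[OF _ open_image[OF assms(1)]])
      (use assms in \<open>auto simp: transition_snd chart\<close>)
  then show ?thesis by (rule frechet_derivative_at[symmetric])
qed

lemma tangent_transition_trans:
  assumes "c \<in> A" "d \<in> A" "e \<in> A" "p \<in> fst c" "p \<in> fst d" "p \<in> fst e"
  shows "tangent_transition d e p (tangent_transition c d p v) = tangent_transition c e p v"
proof -
  have "((\<lambda>x. transition d e (transition c d x)) has_derivative
      (\<lambda>v. tangent_transition d e p (tangent_transition c d p v))) (at (snd c p))"
    using assms by (intro has_derivative_compose[OF transition_has_derivative])
      (simp_all add: transition_snd chart transition_has_derivative)
  then have "(transition c e has_derivative
      (\<lambda>v. tangent_transition d e p (tangent_transition c d p v))) (at (snd c p))"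
    by (rule has_derivative_transform_within_open[OF _ open_overlap[of c d]])
      (use assms in \<open>auto simp: transition_snd chart\<close>)
  from fun_cong[OF frechet_derivative_at[OF this]] show ?thesis .
qed

section \<open>Tangent vectors and velocities in charts\<close>

lemma coord_vec_apply:
  "d \<in> A \<Longrightarrow> p \<in> fst d \<Longrightarrow> coord_vec A c p e d = tangent_transition c d p e"
  by (simp add: coord_vec_def)

lemma coord_vec_self [simp]: "c \<in> A \<Longrightarrow> p \<in> fst c \<Longrightarrow> coord_vec A c p e c = e"
  by (simp add: coord_vec_def tangent_transition_self)

lemma tangent_space_transition:
  "v \<in> tangent_space A p \<Longrightarrow> c \<in> A \<Longrightarrow> d \<in> A \<Longrightarrow> p \<in> fst c \<Longrightarrow> p \<in> fst d \<Longrightarrow>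
    v d = tangent_transition c d p (v c)"
  unfolding tangent_space_def by blast

lemma tangent_space_outside:
  "v \<in> tangent_space A p \<Longrightarrow> \<not> (c \<in> A \<and> p \<in> fst c) \<Longrightarrow> v c = 0"
  unfolding tangent_space_def by blast

lemma tangent_spaceI:
  assumes "\<And>c. \<not> (c \<in> A \<and> p \<in> fst c) \<Longrightarrow> v c = 0"
    and "\<And>c d. c \<in> A \<Longrightarrow> d \<in> A \<Longrightarrow> p \<in> fst c \<Longrightarrow> p \<in> fst d \<Longrightarrow> v d = tangent_transition c d p (v c)"
  shows "v \<in> tangent_space A p"
  unfolding tangent_space_def using assms by blast

lemma coord_vec_in_tangent_space:
  assumes "c \<in> A" "p \<in> fst c"
  shows "coord_vec A c p e \<in> tangent_space A p"
  by (rule tangent_spaceI)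
    (auto simp: coord_vec_def tangent_transition_trans[OF assms(1) _ _ assms(2)])

text \<open>One coordinate vector determines a tangent vector; the value 0 away from the charts at
  \<open>p\<close> makes this an equality of functions.\<close>

lemma coord_vec_of_tangent:
  "v \<in> tangent_space A p \<Longrightarrow> c \<in> A \<Longrightarrow> p \<in> fst c \<Longrightarrow> coord_vec A c p (v c) = v"
  by (rule ext) (simp add: coord_vec_def tangent_space_outside flip: tangent_space_transition[of v p c])

lemma tangent_space_combination:
  assumes "v \<in> tangent_space A p" "w \<in> tangent_space A p"
  shows "(\<lambda>c. a *\<^sub>R v c + b *\<^sub>R w c) \<in> tangent_space A p"
proof (rule tangent_spaceI)
  fix c d assume "c \<in> A" "d \<in> A" "p \<in> fst c" "p \<in> fst d"
  then show "a *\<^sub>R v d + b *\<^sub>R w d = tangent_transition c d p (a *\<^sub>R v c + b *\<^sub>R w c)"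
    using tangent_space_transition[OF assms(1), of c d] tangent_space_transition[OF assms(2), of c d]
    by (simp add: linear_add[OF linear_tangent_transition] linear_cmul[OF linear_tangent_transition])
qed (simp add: tangent_space_outside[OF assms(1)] tangent_space_outside[OF assms(2)])

lemma coord_vec_combination:
  "c \<in> A \<Longrightarrow> p \<in> fst c \<Longrightarrow>
    coord_vec A c p (a *\<^sub>R v + b *\<^sub>R w) = (\<lambda>d. a *\<^sub>R coord_vec A c p v d + b *\<^sub>R coord_vec A c p w d)"
  by (rule ext)
    (simp add: coord_vec_def linear_add[OF linear_tangent_transition] linear_cmul[OF linear_tangent_transition])

text \<open>\<open>J\<close> is there because the map of \<open>c\<close> is arbitrary off its
  domain: composing with the transition gives the coordinates in \<open>d\<close> only while the
  curve stays in \<open>c\<close>.\<close>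

lemma curve_change_chart:
  assumes "c \<in> A" "d \<in> A" "\<gamma> t \<in> fst c" "\<gamma> t \<in> fst d"
    and J: "open J" "t \<in> J" "\<And>s. s \<in> J \<Longrightarrow> \<gamma> s \<in> fst c"
    and D: "((snd c \<circ> \<gamma>) has_vector_derivative e) (at t)"
  shows "((snd d \<circ> \<gamma>) has_vector_derivative tangent_transition c d (\<gamma> t) e) (at t)"
proof -
  have "((\<lambda>s. transition c d ((snd c \<circ> \<gamma>) s)) has_derivative
      (\<lambda>h. tangent_transition c d (\<gamma> t) (h *\<^sub>R e))) (at t)"
    using D transition_has_derivative[of c d "\<gamma> t"] assms
    by (intro has_derivative_compose[where f = "snd c \<circ> \<gamma>" and g = "transition c d"])
      (auto simp: has_vector_derivative_def)
  then have "((snd d \<circ> \<gamma>) has_derivative (\<lambda>h. tangent_transition c d (\<gamma> t) (h *\<^sub>R e))) (at t)"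
    by (rule has_derivative_transform_within_open[OF _ J(1,2)]) (simp add: J assms transition_snd chart)
  then show ?thesis
    using linear_tangent_transition[of c d "\<gamma> t"] assms by (simp add: has_vector_derivative_def linear_cmul)
qed

lemma smooth_curve_has_vector_derivative:
  assumes "smooth_curve A I \<gamma>" "t \<in> I" "c \<in> A" "\<gamma> t \<in> fst c"
  shows "((snd c \<circ> \<gamma>) has_vector_derivative velocity A \<gamma> t c) (at t)"
proof -
  have "(snd c \<circ> \<gamma>) differentiable at t"
    using assms smooth_on_differentiable[of "{t\<in>I. \<gamma> t \<in> fst c}"] by (auto simp: smooth_curve_def)
  then show ?thesis using assms by (simp add: velocity_def vector_derivative_works)
qed

lemma velocity_in_tangent_space:
  assumes "smooth_curve A I \<gamma>" "t \<in> I"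
  shows "velocity A \<gamma> t \<in> tangent_space A (\<gamma> t)"
proof -
  have tr: "velocity A \<gamma> t d = tangent_transition c d (\<gamma> t) (velocity A \<gamma> t c)"
    if "c \<in> A" "d \<in> A" "\<gamma> t \<in> fst c" "\<gamma> t \<in> fst d" for c d
  proof -
    have "((snd d \<circ> \<gamma>) has_vector_derivative tangent_transition c d (\<gamma> t) (velocity A \<gamma> t c)) (at t)"
      by (rule curve_change_chart[where J = "{t\<in>I. \<gamma> t \<in> fst c}"])
        (use assms that smooth_curve_has_vector_derivative[OF assms] in \<open>auto simp: smooth_curve_def\<close>)
    from vector_derivative_unique_at[OF smooth_curve_has_vector_derivative[OF assms that(2,4)] this]
    show ?thesis .
  qed
  show ?thesis by (rule tangent_spaceI[OF _ tr]) (auto simp: velocity_def)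
qed

lemma tangent_space_on_subset: "tangent_space_on A N p \<subseteq> tangent_space A p"
proof
  fix v assume "v \<in> tangent_space_on A N p"
  then obtain \<gamma> e where "v = velocity A \<gamma> 0" "0 < e" "smooth_curve A {-e<..<e} \<gamma>" "\<gamma> 0 = p"
    by (auto simp: tangent_space_on_def)
  then show "v \<in> tangent_space A p" using velocity_in_tangent_space[of "{-e<..<e}" \<gamma> 0] by simp
qed

lemma openin_manifold_topology:
  "openin (manifold_topology A) W \<longleftrightarrow> W \<subseteq> carrier_of A \<and> (\<forall>c\<in>A. open (snd c ` (W \<inter> fst c)))"
proof -
  have "istopology (\<lambda>W. W \<subseteq> carrier_of A \<and> (\<forall>c\<in>A. open (snd c ` (W \<inter> fst c))))"
    unfolding istopology_def
  proof (intro conjI allI impI ballI)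
    fix S T c assume S: "S \<subseteq> carrier_of A \<and> (\<forall>c\<in>A. open (snd c ` (S \<inter> fst c)))"
      and T: "T \<subseteq> carrier_of A \<and> (\<forall>c\<in>A. open (snd c ` (T \<inter> fst c)))" and c: "c \<in> A"
    \<comment> \<open>Images commute with intersections here because chart maps are
      injective.\<close>
    have "inj_on (snd c) (fst c)" using chart[OF c] by (simp add: is_chart_def)
    then have "snd c ` (S \<inter> T \<inter> fst c) = snd c ` (S \<inter> fst c) \<inter> snd c ` (T \<inter> fst c)"
      by (auto simp: inj_on_def)
    then show "open (snd c ` (S \<inter> T \<inter> fst c))" using S T c by auto
  next
    fix \<K> c assume K: "\<forall>K\<in>\<K>. K \<subseteq> carrier_of A \<and> (\<forall>c\<in>A. open (snd c ` (K \<inter> fst c)))" and c: "c \<in> A"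
    have "snd c ` (\<Union>\<K> \<inter> fst c) = (\<Union>K\<in>\<K>. snd c ` (K \<inter> fst c))" by auto
    then show "open (snd c ` (\<Union>\<K> \<inter> fst c))" using K c by auto
  qed auto
  then show ?thesis unfolding manifold_topology_def by simp
qed

end

lemma compatible_sym: "compatible c d \<Longrightarrow> compatible d c"
  by (simp add: compatible_def Int_commute)

lemma compatible_self:
  assumes "is_chart c"
  shows "compatible c c"
proof -
  have "open (snd c ` fst c)" using assms by (simp add: is_chart_def)
  moreover have "smooth_on (snd c ` fst c) (transition c c)"
    by (subst smooth_on_cong[OF calculation, of _ "\<lambda>x. x"])
      (auto simp: assms transition_snd smooth_on_id)
  ultimately show ?thesis by (simp add: compatible_def)
qed

locale smooth_atlas =
  fixes A :: "('p, 'e::euclidean_space) chart set"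
  assumes is_chart: "c \<in> A \<Longrightarrow> is_chart c" and compatible: "c \<in> A \<Longrightarrow> d \<in> A \<Longrightarrow> compatible c d"

sublocale smooth_atlas \<subseteq> differentiable_atlas
proof
  fix c d p assume "c \<in> A" "d \<in> A"
  then show "open (snd c ` (fst c \<inter> fst d))"
    "p \<in> fst c \<Longrightarrow> p \<in> fst d \<Longrightarrow> transition c d differentiable at (snd c p)"
    using compatible[of c d] by (auto simp: compatible_def intro: smooth_on_differentiable)
qed (rule is_chart)

lemma smooth_manifold_imp_smooth_atlas: "smooth_manifold A \<Longrightarrow> smooth_atlas A"
  by (simp add: smooth_manifold_def smooth_atlas_def)

text \<open>Slice charts of submanifolds come from the maximal atlas. Adjoining one at a time makes
  its transition maps to \<open>A\<close> available without comparing two charts of the maximal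
  atlas with each other.\<close>

lemma (in smooth_atlas) smooth_atlas_insert_maximal:
  assumes "d \<in> maximal_atlas A"
  shows "smooth_atlas (insert d A)"
proof -
  have d: "is_chart d" "\<And>c. c \<in> A \<Longrightarrow> compatible d c"
    using assms by (auto simp: maximal_atlas_def)
  show ?thesis
    by standard (use d is_chart compatible compatible_self compatible_sym in blast)+
qed

lemma (in smooth_atlas) smooth_transition:
  "c \<in> A \<Longrightarrow> d \<in> A \<Longrightarrow> smooth_on (snd c ` (fst c \<inter> fst d)) (transition c d)"
  using compatible by (simp add: compatible_def)

section \<open>The exterior derivative in different charts\<close>

text \<open>The formula of \<open>ext_deriv\<close> with the chart as a parameter in place of the
  choice made by \<open>chart_at\<close>, so that two charts can be compared.\<close>

definition local_ext_deriv ::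
  "('p, 'e::euclidean_space) chart set \<Rightarrow> ('p \<Rightarrow> ('p, 'e) tvec \<Rightarrow> real) \<Rightarrow>
   ('p, 'e) chart \<Rightarrow> 'e \<Rightarrow> 'e \<Rightarrow> 'e \<Rightarrow> real" where
  "local_ext_deriv A \<alpha> c x a b =
     frechet_derivative (\<lambda>y. coord_form A \<alpha> c y b) (at x) a
   - frechet_derivative (\<lambda>y. coord_form A \<alpha> c y a) (at x) b"

locale one_form_atlas = smooth_atlas A
  for A :: "('p, 'e::euclidean_space) chart set" +
  fixes \<alpha> :: "'p \<Rightarrow> ('p, 'e) tvec \<Rightarrow> real"
  assumes smooth_form: "smooth_one_form A \<alpha>"
begin

lemma form_combination:
  assumes "p \<in> carrier_of A" "v \<in> tangent_space A p" "w \<in> tangent_space A p"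
  shows "\<alpha> p (\<lambda>c. a *\<^sub>R v c + b *\<^sub>R w c) = a * \<alpha> p v + b * \<alpha> p w"
  using smooth_form assms unfolding smooth_one_form_def cotangent_space_def by blast

lemma form_eq_coord_form:
  assumes "c \<in> A" "p \<in> fst c" "v \<in> tangent_space A p"
  shows "\<alpha> p v = coord_form A \<alpha> c (snd c p) (v c)"
  using assms by (simp add: coord_form_def chart_inv_snd chart coord_vec_of_tangent)

lemma linear_coord_form:
  assumes c: "c \<in> A" and x: "x \<in> snd c ` fst c"
  shows "linear (coord_form A \<alpha> c x)"
proof -
  let ?p = "chart_inv c x"
  have p: "?p \<in> fst c" by (rule chart_inv_in[OF x])
  then have pc: "?p \<in> carrier_of A" using c by (auto simp: carrier_of_def)
  have *: "coord_form A \<alpha> c x (a *\<^sub>R v + b *\<^sub>R w) = a * coord_form A \<alpha> c x v + b * coord_form A \<alpha> c x w" for a b v w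
    unfolding coord_form_def coord_vec_combination[OF c p]
    by (intro form_combination coord_vec_in_tangent_space c p pc)
  show ?thesis
  proof
    show "coord_form A \<alpha> c x (v + w) = coord_form A \<alpha> c x v + coord_form A \<alpha> c x w" for v w
      using *[of 1 v 1 w] by simp
    show "coord_form A \<alpha> c x (a *\<^sub>R v) = a *\<^sub>R coord_form A \<alpha> c x v" for a v
      using *[of a v 0 v] by simp
  qed
qed

lemma coord_form_differentiable:
  assumes "c \<in> A" "x \<in> snd c ` fst c"
  shows "(\<lambda>y. coord_form A \<alpha> c y e) differentiable at x"
  using smooth_form assms smooth_on_differentiable unfolding smooth_one_form_def by blast

lemma coord_form_has_derivative:
  assumes "c \<in> A" "x \<in> snd c ` fst c" "(g has_derivative g') (at x)"
  shows "((\<lambda>y. coord_form A \<alpha> c y (g y)) has_derivative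
    (\<lambda>k. frechet_derivative (\<lambda>y. coord_form A \<alpha> c y (g x)) (at x) k + coord_form A \<alpha> c x (g' k))) (at x)"
  using assms by (intro has_derivative_pointwise_linear[OF open_image])
    (auto intro: linear_coord_form coord_form_differentiable)

lemma coord_form_transition:
  assumes c: "c \<in> A" and d: "d \<in> A" and x: "x \<in> snd c ` (fst c \<inter> fst d)"
  shows "coord_form A \<alpha> c x e
    = coord_form A \<alpha> d (transition c d x) (frechet_derivative (transition c d) (at x) e)"
proof -
  from x obtain p where p: "p \<in> fst c" "p \<in> fst d" "x = snd c p" by auto
  have "coord_vec A c p e = coord_vec A d p (coord_vec A c p e d)"
    using coord_vec_of_tangent[OF coord_vec_in_tangent_space] c d p by metis
  then show ?thesis
    using c d p by (simp add: coord_form_def chart_inv_snd chart transition_snd coord_vec_apply)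
qed

text \<open>The second derivatives of the transition map enter symmetrically and cancel.\<close>

lemma local_ext_deriv_transition:
  assumes c: "c \<in> A" and d: "d \<in> A" and x: "x \<in> snd c ` (fst c \<inter> fst d)"
  defines "D \<equiv> frechet_derivative (transition c d) (at x)"
  shows "local_ext_deriv A \<alpha> c x a b = local_ext_deriv A \<alpha> d (transition c d x) (D a) (D b)"
proof -
  let ?\<phi> = "transition c d" and ?U = "snd c ` (fst c \<inter> fst d)"
  have U: "open ?U" using open_overlap c d by blast
  have sm: "smooth_on ?U ?\<phi>" using smooth_transition c d by blast
  have \<phi>d: "(?\<phi> has_derivative frechet_derivative ?\<phi> (at y)) (at y)" if "y \<in> ?U" for y
    using sm that smooth_on_differentiable frechet_derivative_works by blast
  have img: "?\<phi> y \<in> snd d ` fst d" if "y \<in> ?U" for y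
    using that c by (auto simp: transition_snd chart)
  have hd: "((\<lambda>y. coord_form A \<alpha> d y e) has_derivative
      frechet_derivative (\<lambda>y. coord_form A \<alpha> d y e) (at (?\<phi> x))) (at (?\<phi> x))" for e
    using coord_form_differentiable[OF d img[OF x]] frechet_derivative_works by blast
  have pull: "((\<lambda>y. coord_form A \<alpha> d (?\<phi> y) e) has_derivative
      (\<lambda>k. frechet_derivative (\<lambda>y. coord_form A \<alpha> d y e) (at (?\<phi> x)) (D k))) (at x)" for e
    unfolding D_def by (rule has_derivative_compose[OF \<phi>d[OF x] hd])
  \<comment> \<open>Product rule for the pullback law \<open>coord_form_transition\<close>: one term
    transports the derivative of the form, the other is the form applied to a second derivative of
    the transition map.\<close>
  have key: "frechet_derivative (\<lambda>y. coord_form A \<alpha> c y e) (at x) k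
      = frechet_derivative (\<lambda>y. coord_form A \<alpha> d y (D e)) (at (?\<phi> x)) (D k)
      + coord_form A \<alpha> d (?\<phi> x) (frechet_derivative (\<lambda>y. frechet_derivative ?\<phi> (at y) e) (at x) k)" for e k
  proof -
    have g: "((\<lambda>y. frechet_derivative ?\<phi> (at y) e) has_derivative
        frechet_derivative (\<lambda>y. frechet_derivative ?\<phi> (at y) e) (at x)) (at x)"
      using smooth_on_differentiable[OF smooth_on_derivative[OF sm] x] frechet_derivative_works by blast
    have "((\<lambda>y. coord_form A \<alpha> d (?\<phi> y) (frechet_derivative ?\<phi> (at y) e)) has_derivative
        (\<lambda>k. frechet_derivative (\<lambda>y. coord_form A \<alpha> d (?\<phi> y) (frechet_derivative ?\<phi> (at x) e)) (at x) k
          + coord_form A \<alpha> d (?\<phi> x) (frechet_derivative (\<lambda>y. frechet_derivative ?\<phi> (at y) e) (at x) k))) (at x)"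
    proof (rule has_derivative_pointwise_linear[OF U x _ _ g])
      show "linear (coord_form A \<alpha> d (?\<phi> y))" if "y \<in> ?U" for y
        using linear_coord_form[OF d img[OF that]] .
      show "(\<lambda>y. coord_form A \<alpha> d (?\<phi> y) e) differentiable at x" for e
        using pull differentiable_def by blast
    qed
    then have "((\<lambda>y. coord_form A \<alpha> c y e) has_derivative
        (\<lambda>k. frechet_derivative (\<lambda>y. coord_form A \<alpha> d (?\<phi> y) (frechet_derivative ?\<phi> (at x) e)) (at x) k
          + coord_form A \<alpha> d (?\<phi> x) (frechet_derivative (\<lambda>y. frechet_derivative ?\<phi> (at y) e) (at x) k))) (at x)"
      by (rule has_derivative_transform_within_open[OF _ U x]) (simp add: coord_form_transition[OF c d])
    from fun_cong[OF frechet_derivative_at[OF this], of k]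
      fun_cong[OF frechet_derivative_at[OF pull[of "D e"]], of k]
    show ?thesis by (simp add: D_def)
  qed
  show ?thesis
    unfolding local_ext_deriv_def key
      smooth_on_second_derivative_symmetric[OF sm U x, of a b] by simp
qed

text \<open>This frees \<open>ext_deriv\<close> from the chosen chart. On the cover the computation
  takes place over whatever base chart the choice there happens to give.\<close>

lemma ext_deriv_eq_local:
  assumes "c \<in> A" "p \<in> fst c" "v \<in> tangent_space A p" "w \<in> tangent_space A p"
  shows "ext_deriv A \<alpha> p v w = local_ext_deriv A \<alpha> c (snd c p) (v c) (w c)"
proof -
  have p: "p \<in> carrier_of A" using assms by (auto simp: carrier_of_def)
  let ?d = "chart_at A p"
  have "ext_deriv A \<alpha> p v w = local_ext_deriv A \<alpha> ?d (snd ?d p) (v ?d) (w ?d)"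
    by (simp add: ext_deriv_def local_ext_deriv_def Let_def)
  also have "\<dots> = local_ext_deriv A \<alpha> c (snd c p) (v c) (w c)"
    using local_ext_deriv_transition[of ?d c "snd ?d p" "v ?d" "w ?d"] chart_at[OF p] assms
      tangent_space_transition[of v p ?d c] tangent_space_transition[of w p ?d c]
    by (simp add: transition_snd chart)
  finally show ?thesis .
qed

text \<open>The two halves of \<open>ext_deriv\<close> use different linearities: of a derivative in
  its direction, and of the coefficients in their vector. The latter holds on the whole chart and so
  survives differentiation.\<close>

lemma ext_deriv_add_scaled:
  assumes p: "p \<in> carrier_of A"
    and u: "u \<in> tangent_space A p" and v: "v \<in> tangent_space A p"
  shows "ext_deriv A \<alpha> p (\<lambda>c. u c + h *\<^sub>R v c) w = ext_deriv A \<alpha> p u w + h * ext_deriv A \<alpha> p v w"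
proof -
  let ?c = "chart_at A p"
  let ?x = "snd ?c p"
  have c: "?c \<in> A" "p \<in> fst ?c" using chart_at[OF p] by auto
  then have x: "?x \<in> snd ?c ` fst ?c" by auto
  have hd: "((\<lambda>y. coord_form A \<alpha> ?c y e) has_derivative
      frechet_derivative (\<lambda>y. coord_form A \<alpha> ?c y e) (at ?x)) (at ?x)" for e
    using coord_form_differentiable[OF c(1) x] frechet_derivative_works by blast
  have "((\<lambda>y. coord_form A \<alpha> ?c y (u ?c) + h * coord_form A \<alpha> ?c y (v ?c)) has_derivative
      (\<lambda>k. frechet_derivative (\<lambda>y. coord_form A \<alpha> ?c y (u ?c)) (at ?x) k
        + h * frechet_derivative (\<lambda>y. coord_form A \<alpha> ?c y (v ?c)) (at ?x) k)) (at ?x)"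
    by (intro has_derivative_add has_derivative_mult_right hd)
  then have "((\<lambda>y. coord_form A \<alpha> ?c y (u ?c + h *\<^sub>R v ?c)) has_derivative
      (\<lambda>k. frechet_derivative (\<lambda>y. coord_form A \<alpha> ?c y (u ?c)) (at ?x) k
        + h * frechet_derivative (\<lambda>y. coord_form A \<alpha> ?c y (v ?c)) (at ?x) k)) (at ?x)"
    by (rule has_derivative_transform_within_open[OF _ open_image[OF c(1)] x])
      (simp add: linear_add[OF linear_coord_form[OF c(1)]] linear_cmul[OF linear_coord_form[OF c(1)]])
  from fun_cong[OF frechet_derivative_at[OF this]]
  show ?thesis
    using has_derivative_linear[OF hd]
    by (simp add: ext_deriv_def Let_def linear_add linear_cmul algebra_simps)
qed

end

lemma (in differentiable_atlas) dir_deriv_velocity: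
  assumes f: "smooth_function A f" and \<gamma>: "smooth_curve A I \<gamma>" and t: "t \<in> I"
  shows "((\<lambda>s. f (\<gamma> s)) has_real_derivative dir_deriv A f (\<gamma> t) (velocity A \<gamma> t)) (at t)"
proof -
  let ?c = "chart_at A (\<gamma> t)"
  have "\<gamma> t \<in> carrier_of A" using \<gamma> t by (auto simp: smooth_curve_def)
  then have c: "?c \<in> A" "\<gamma> t \<in> fst ?c" using chart_at by auto
  let ?F = "frechet_derivative (f \<circ> chart_inv ?c) (at (snd ?c (\<gamma> t)))"
  have F: "((f \<circ> chart_inv ?c) has_derivative ?F) (at ((snd ?c \<circ> \<gamma>) t))"
    using f c smooth_on_differentiable[of "snd ?c ` fst ?c"] frechet_derivative_works
    by (fastforce simp: smooth_function_def)
  have "((\<lambda>s. (f \<circ> chart_inv ?c) ((snd ?c \<circ> \<gamma>) s)) has_derivative (\<lambda>h. ?F (h *\<^sub>R velocity A \<gamma> t ?c))) (at t)"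
    by (rule has_derivative_compose[OF
          smooth_curve_has_vector_derivative[OF \<gamma> t c, unfolded has_vector_derivative_def] F])
  then have "((\<lambda>s. f (\<gamma> s)) has_derivative (\<lambda>h. ?F (h *\<^sub>R velocity A \<gamma> t ?c))) (at t)"
  proof (rule has_derivative_transform_within_open)
    show "open {s\<in>I. \<gamma> s \<in> fst ?c}" using \<gamma> c by (simp add: smooth_curve_def)
  qed (use c t in \<open>auto simp: chart_inv_snd chart\<close>)
  moreover have "(\<lambda>h. ?F (h *\<^sub>R velocity A \<gamma> t ?c)) = (*) (?F (velocity A \<gamma> t ?c))"
    using has_derivative_linear[OF F] by (auto simp: linear_cmul)
  ultimately show ?thesis by (simp add: has_field_derivative_def dir_deriv_def Let_def)
qed

section \<open>The symplectic cover\<close>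

text \<open>Since \<eta> vanishes nowhere, a covector s \<eta> determines s, which gives the
  \<open>THE\<close> in \<open>cover_chart\<close> its meaning.\<close>

locale nowhere_zero_form_atlas = one_form_atlas A \<eta>
  for A :: "('p, 'e::euclidean_space) chart set" and \<eta> :: "'p \<Rightarrow> ('p, 'e) tvec \<Rightarrow> real" +
  assumes nonzero: "p \<in> carrier_of A \<Longrightarrow> \<exists>v. \<eta> p v \<noteq> 0"
begin

section \<open>Points and charts of the cover\<close>

abbreviation B :: "(('p, 'e) covector_point, 'e \<times> real) chart set" where
  "B \<equiv> cover_atlas A \<eta>"

abbreviation K :: "('p, 'e) chart \<Rightarrow> (('p, 'e) covector_point, 'e \<times> real) chart" where
  "K \<equiv> cover_chart A \<eta>"

definition cover_pt :: "'p \<Rightarrow> real \<Rightarrow> ('p, 'e) covector_point" where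
  "cover_pt p s = (p, \<lambda>v. s * \<eta> p v)"

lemma fst_cover_pt [simp]: "fst (cover_pt p s) = p"
  by (simp add: cover_pt_def)

lemma in_carrier: "c \<in> A \<Longrightarrow> p \<in> fst c \<Longrightarrow> p \<in> carrier_of A"
  by (auto simp: carrier_of_def)

lemma multiple_eq_iff:
  assumes "p \<in> carrier_of A"
  shows "(\<lambda>v. s * \<eta> p v) = (\<lambda>v. t * \<eta> p v) \<longleftrightarrow> s = t"
  using nonzero[OF assms] by (auto simp: fun_eq_iff)

lemma cover_pt_in_cover_points: "p \<in> carrier_of A \<Longrightarrow> cover_pt p s \<in> cover_points A \<eta> \<longleftrightarrow> s \<noteq> 0"
  by (auto simp: cover_pt_def cover_points_def multiple_eq_iff)

lemma cover_pointsE: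
  assumes "q \<in> cover_points A \<eta>"
  obtains p s where "p \<in> carrier_of A" "s \<noteq> 0" "q = cover_pt p s"
  using assms by (auto simp: cover_pt_def cover_points_def)

lemma cover_pt_in_chart: "c \<in> A \<Longrightarrow> cover_pt p s \<in> fst (K c) \<longleftrightarrow> p \<in> fst c \<and> s \<noteq> 0"
  by (cases "p \<in> fst c") (auto simp: cover_chart_def cover_pt_in_cover_points in_carrier)

lemma in_cover_chart: "q \<in> fst (K c) \<longleftrightarrow> q \<in> cover_points A \<eta> \<and> fst q \<in> fst c"
  by (auto simp: cover_chart_def)

lemma snd_cover_chart: "p \<in> carrier_of A \<Longrightarrow> snd (K c) (cover_pt p s) = (snd c p, s)"
  by (simp add: cover_chart_def cover_pt_def multiple_eq_iff)

lemma fst_snd_cover_chart: "fst (snd (K c) q) = snd c (fst q)"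
  by (simp add: cover_chart_def split: prod.split)

lemma cover_atlasE:
  assumes "C \<in> B" obtains c where "c \<in> A" "C = K c"
  using assms by (auto simp: cover_atlas_def)

lemma K_in_B: "c \<in> A \<Longrightarrow> K c \<in> B"
  by (simp add: cover_atlas_def)

lemma cover_pt_in_carrier:
  assumes "p \<in> carrier_of A" "s \<noteq> 0"
  shows "cover_pt p s \<in> carrier_of B"
proof -
  obtain c where c: "c \<in> A" "p \<in> fst c" using assms unfolding carrier_of_def by blast
  then have "cover_pt p s \<in> fst (K c)" using assms cover_pt_in_chart by blast
  then show ?thesis using K_in_B[OF c(1)] unfolding carrier_of_def by blast
qed

text \<open>In these charts the cover is the base times the punctured line, and a change of chart
  acts on the base factor only.\<close>

lemma cover_overlap_image:
  assumes "c \<in> A" "d \<in> A"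
  shows "snd (K c) ` (fst (K c) \<inter> fst (K d)) = (snd c ` (fst c \<inter> fst d)) \<times> (- {0})"
proof (intro equalityI subsetI)
  fix z assume "z \<in> snd (K c) ` (fst (K c) \<inter> fst (K d))"
  then obtain q where q: "q \<in> cover_points A \<eta>" "fst q \<in> fst c" "fst q \<in> fst d" "z = snd (K c) q"
    by (auto simp: in_cover_chart)
  then obtain p s where "p \<in> carrier_of A" "s \<noteq> 0" "q = cover_pt p s" by (auto elim: cover_pointsE)
  with q show "z \<in> (snd c ` (fst c \<inter> fst d)) \<times> (- {0})" by (auto simp: snd_cover_chart)
next
  fix z assume "z \<in> (snd c ` (fst c \<inter> fst d)) \<times> (- {0::real})"
  then obtain p s where p: "p \<in> fst c" "p \<in> fst d" "s \<noteq> 0" "z = (snd c p, s)" by auto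
  then have "z = snd (K c) (cover_pt p s)" using snd_cover_chart in_carrier assms by simp
  moreover have "cover_pt p s \<in> fst (K c) \<inter> fst (K d)" using p assms cover_pt_in_chart by simp
  ultimately show "z \<in> snd (K c) ` (fst (K c) \<inter> fst (K d))" by blast
qed

lemma is_chart_cover:
  assumes c: "c \<in> A"
  shows "is_chart (K c)"
proof -
  have "inj_on (snd (K c)) (fst (K c))"
  proof (rule inj_onI)
    fix q r assume "q \<in> fst (K c)" "r \<in> fst (K c)" and eq: "snd (K c) q = snd (K c) r"
    then have qr: "q \<in> cover_points A \<eta>" "r \<in> cover_points A \<eta>" "fst q \<in> fst c" "fst r \<in> fst c"
      by (simp_all add: in_cover_chart)
    obtain p s where q: "p \<in> carrier_of A" "q = cover_pt p s" using qr(1) by (rule cover_pointsE)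
    obtain p' s' where r: "p' \<in> carrier_of A" "r = cover_pt p' s'" using qr(2) by (rule cover_pointsE)
    have "snd c p = snd c p'" "s = s'" using eq q r by (simp_all add: snd_cover_chart)
    then show "q = r" using q r qr(3,4) chart_inv_snd[OF chart[OF c]] by (metis fst_cover_pt)
  qed
  moreover have "open (snd (K c) ` fst (K c))"
    using cover_overlap_image[OF c c] open_image[OF c] by (simp add: open_Times open_Compl)
  ultimately show ?thesis by (simp add: is_chart_def)
qed

lemma chart_inv_cover:
  assumes "c \<in> A" "p \<in> fst c" "s \<noteq> 0"
  shows "chart_inv (K c) (snd c p, s) = cover_pt p s"
  using chart_inv_snd[OF is_chart_cover, of c "cover_pt p s"] assms
  by (simp add: cover_pt_in_chart snd_cover_chart in_carrier)

lemma transition_cover: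
  assumes "c \<in> A" "d \<in> A" "p \<in> fst c" "p \<in> fst d" "s \<noteq> 0"
  shows "transition (K c) (K d) (snd c p, s) = (snd d p, s)"
  using assms by (simp add: transition_def chart_inv_cover snd_cover_chart in_carrier)

lemma open_cover_overlap:
  "c \<in> A \<Longrightarrow> d \<in> A \<Longrightarrow> open ((snd c ` (fst c \<inter> fst d)) \<times> (- {0::real}))"
  by (intro open_Times open_overlap) (auto simp: open_Compl)

lemma has_derivative_transition_fst:
  assumes "c \<in> A" "d \<in> A" "p \<in> fst c" "p \<in> fst d"
  shows "((\<lambda>z. transition c d (fst z)) has_derivative (\<lambda>e. tangent_transition c d p (fst e)))
    (at (snd c p, s))"
proof (rule has_derivative_compose[where f = fst and f' = fst and g = "transition c d"
      and g' = "tangent_transition c d p"])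
  show "(fst has_derivative fst) (at (snd c p, s))"
    by (rule bounded_linear_imp_has_derivative) (rule bounded_linear_fst)
  show "(transition c d has_derivative tangent_transition c d p) (at (fst (snd c p, s)))"
    using transition_has_derivative assms by simp
qed

lemma transition_cover_has_derivative:
  assumes "c \<in> A" "d \<in> A" "p \<in> fst c" "p \<in> fst d" "s \<noteq> 0"
  shows "(transition (K c) (K d) has_derivative (\<lambda>e. (tangent_transition c d p (fst e), snd e)))
    (at (snd c p, s))"
proof -
  have "((\<lambda>z. (transition c d (fst z), snd z)) has_derivative
      (\<lambda>e. (tangent_transition c d p (fst e), snd e))) (at (snd c p, s))"
    by (rule has_derivative_Pair[OF has_derivative_transition_fst[OF assms(1-4)]
          bounded_linear_imp_has_derivative[OF bounded_linear_snd]])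
  then show ?thesis
  proof (rule has_derivative_transform_within_open[OF _ open_cover_overlap[OF assms(1,2)]])
    fix z assume "z \<in> (snd c ` (fst c \<inter> fst d)) \<times> (- {0::real})"
    then obtain p' s' where "p' \<in> fst c" "p' \<in> fst d" "s' \<noteq> 0" "z = (snd c p', s')" by auto
    then show "(transition c d (fst z), snd z) = transition (K c) (K d) z"
      using assms by (simp add: transition_cover transition_snd chart)
  qed (use assms in auto)
qed

end

sublocale nowhere_zero_form_atlas \<subseteq> cover: differentiable_atlas "cover_atlas A \<eta>"
proof
  fix C D assume "C \<in> B" "D \<in> B"
  then obtain c d where cd: "c \<in> A" "C = K c" "d \<in> A" "D = K d" by (metis cover_atlasE)
  then show "is_chart C" using is_chart_cover by simp
  show "open (snd C ` (fst C \<inter> fst D))" using cd cover_overlap_image open_cover_overlap by simp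
  show "transition C D differentiable at (snd C q)" if q: "q \<in> fst C" "q \<in> fst D" for q
  proof -
    obtain p s where "q = cover_pt p s" "p \<in> fst c" "p \<in> fst d" "s \<noteq> 0" "p \<in> carrier_of A"
      using q cd by (auto simp: in_cover_chart elim!: cover_pointsE)
    then show ?thesis
      using transition_cover_has_derivative[of c d p s] cd
      by (auto simp: snd_cover_chart differentiable_def)
  qed
qed

section \<open>Tangent vectors of the cover\<close>

context nowhere_zero_form_atlas
begin

lemma tangent_transition_cover:
  assumes "c \<in> A" "d \<in> A" "p \<in> fst c" "p \<in> fst d" "s \<noteq> 0"
  shows "tangent_transition (K c) (K d) (cover_pt p s) e = (tangent_transition c d p (fst e), snd e)"
  using fun_cong[OF frechet_derivative_at[OF transition_cover_has_derivative[OF assms]], of e] assms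
  by (simp add: snd_cover_chart in_carrier)

text \<open>This is \<pi>_* V read off in each chart separately, whereas \<open>pushforward\<close>
  computes in one chosen chart of the cover; \<open>pushforward_fst\<close> identifies the
  two.\<close>

definition base_vec ::
  "'p \<Rightarrow> (('p, 'e) covector_point, 'e \<times> real) tvec \<Rightarrow> ('p, 'e) tvec" where
  "base_vec p V = (\<lambda>d. if d \<in> A \<and> p \<in> fst d then fst (V (K d)) else 0)"

text \<open>All cover charts share the coordinate s, so the fibre component of a tangent vector is
  the same in each of them. This justifies writing the vector as a pair (v, a).\<close>

lemma cover_tangent_transition:
  assumes V: "V \<in> tangent_space B (cover_pt p s)" and s: "s \<noteq> 0"
    and c: "c \<in> A" "p \<in> fst c" and d: "d \<in> A" "p \<in> fst d"
  shows "V (K d) = (tangent_transition c d p (fst (V (K c))), snd (V (K c)))"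
  using cover.tangent_space_transition[OF V K_in_B[OF c(1)] K_in_B[OF d(1)]]
  by (simp add: cover_pt_in_chart tangent_transition_cover c d s)

lemma base_vec_in_tangent_space:
  assumes "V \<in> tangent_space B (cover_pt p s)" "s \<noteq> 0"
  shows "base_vec p V \<in> tangent_space A p"
  by (rule tangent_spaceI) (auto simp: base_vec_def dest: cover_tangent_transition[OF assms])

lemma base_vec_coord_vec:
  assumes "c \<in> A" "p \<in> fst c" "s \<noteq> 0"
  shows "base_vec p (coord_vec B (K c) (cover_pt p s) e) = coord_vec A c p (fst e)"
  using assms
  by (auto simp: base_vec_def coord_vec_def K_in_B cover_pt_in_chart tangent_transition_cover)

lemma pushforward_fst:
  assumes V: "V \<in> tangent_space B (cover_pt p s)" and s: "s \<noteq> 0" and p: "p \<in> carrier_of A"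
  shows "pushforward B A fst (cover_pt p s) V = base_vec p V"
proof
  fix d
  have "cover_pt p s \<in> carrier_of B" using p s by (rule cover_pt_in_carrier)
  then obtain c where c: "c \<in> A" "p \<in> fst c" "chart_at B (cover_pt p s) = K c"
    using cover.chart_at s by (metis cover_atlasE cover_pt_in_chart)
  show "pushforward B A fst (cover_pt p s) V d = base_vec p V d"
  proof (cases "d \<in> A \<and> p \<in> fst d")
    case True
    have "((\<lambda>z. transition c d (fst z)) has_derivative (\<lambda>e. tangent_transition c d p (fst e)))
        (at (snd c p, s))"
      using c True by (intro has_derivative_transition_fst) auto
    \<comment> \<open>In the charts \<open>K c\<close> and \<open>d\<close> the projection is
      \<open>transition c d\<close> after \<open>fst\<close>.\<close>
    then have "((snd d \<circ> fst \<circ> chart_inv (K c)) has_derivative (\<lambda>e. tangent_transition c d p (fst e)))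
        (at (snd c p, s))"
    proof (rule has_derivative_transform_within_open[OF _ open_cover_overlap[of c d]])
      fix z assume "z \<in> (snd c ` (fst c \<inter> fst d)) \<times> (- {0::real})"
      then obtain p' s' where "p' \<in> fst c" "p' \<in> fst d" "s' \<noteq> 0" "z = (snd c p', s')" by auto
      then show "transition c d (fst z) = (snd d \<circ> fst \<circ> chart_inv (K c)) z"
        using c by (simp add: chart_inv_cover transition_snd chart)
    qed (use c True s in auto)
    from fun_cong[OF frechet_derivative_at[OF this], of "V (K c)"] show ?thesis
      using True c p cover_tangent_transition[OF V s c(1,2), of d]
      by (simp add: pushforward_def Let_def base_vec_def snd_cover_chart)
  qed (auto simp: pushforward_def base_vec_def Let_def)
qed

section \<open>The canonical form and its differential\<close>

lemma cover_one_form_eq: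
  assumes "V \<in> tangent_space B (cover_pt p s)" "s \<noteq> 0" "p \<in> carrier_of A"
  shows "cover_one_form A \<eta> (cover_pt p s) V = s * \<eta> p (base_vec p V)"
  by (simp add: cover_one_form_def pushforward_fst[OF assms]) (simp add: cover_pt_def)

lemma coord_form_cover:
  assumes c: "c \<in> A" and x: "x \<in> snd c ` fst c" and s: "s \<noteq> 0"
  shows "coord_form B (cover_one_form A \<eta>) (K c) (x, s) e = s * coord_form A \<eta> c x (fst e)"
proof -
  from x obtain p where p: "p \<in> fst c" "x = snd c p" by auto
  have "coord_vec B (K c) (cover_pt p s) e \<in> tangent_space B (cover_pt p s)"
    using c p s by (intro cover.coord_vec_in_tangent_space) (auto simp: K_in_B cover_pt_in_chart)
  then show ?thesis
    using c p s by (simp add: coord_form_def chart_inv_cover cover_one_form_eq in_carrier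
        base_vec_coord_vec chart_inv_snd chart)
qed

text \<open>Product rule for s \<eta>: differentiating the factor s produces the terms of \<Omega>
  that pair a fibre component with \<eta>.\<close>

lemma coord_form_cover_derivative:
  assumes c: "c \<in> A" and x: "x \<in> snd c ` fst c" and s: "s \<noteq> 0"
  shows "frechet_derivative (\<lambda>z. coord_form B (cover_one_form A \<eta>) (K c) z e) (at (x, s)) k
    = s * frechet_derivative (\<lambda>y. coord_form A \<eta> c y (fst e)) (at x) (fst k)
      + snd k * coord_form A \<eta> c x (fst e)"
proof -
  let ?h = "\<lambda>y. coord_form A \<eta> c y (fst e)"
  have h: "(?h has_derivative frechet_derivative ?h (at x)) (at x)"
    using coord_form_differentiable[OF c x] frechet_derivative_works by blast
  have f: "(fst has_derivative fst) (at (x, s))" and g: "(snd has_derivative snd) (at (x, s))"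
    by (intro bounded_linear_imp_has_derivative bounded_linear_fst bounded_linear_snd)+
  have "((\<lambda>z. ?h (fst z)) has_derivative (\<lambda>k. frechet_derivative ?h (at x) (fst k))) (at (x, s))"
    by (rule has_derivative_compose[OF f]) (simp add: h)
  from has_derivative_mult[OF g this]
  have "((\<lambda>z. snd z * ?h (fst z)) has_derivative
      (\<lambda>k. s * frechet_derivative ?h (at x) (fst k) + snd k * ?h x)) (at (x, s))"
    by simp
  then have "((\<lambda>z. coord_form B (cover_one_form A \<eta>) (K c) z e) has_derivative
      (\<lambda>k. s * frechet_derivative ?h (at x) (fst k) + snd k * ?h x)) (at (x, s))"
  proof (rule has_derivative_transform_within_open[OF _ open_cover_overlap[OF c c]])
    fix z assume "z \<in> (snd c ` (fst c \<inter> fst c)) \<times> (- {0::real})"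
    then obtain p' s' where "p' \<in> fst c" "s' \<noteq> 0" "z = (snd c p', s')" by auto
    then show "snd z * ?h (fst z) = coord_form B (cover_one_form A \<eta>) (K c) z e"
      by (simp add: coord_form_cover[OF c])
  qed (use x s in auto)
  from fun_cong[OF frechet_derivative_at[OF this], of k] show ?thesis by simp
qed

text \<open>The left side is evaluated in a chart \<open>K d\<close> outside one's control. The
  right side does not depend on the chart, by \<open>ext_deriv_eq_local\<close> and
  \<open>cover_tangent_transition\<close>, so any \<open>c\<close> around \<open>p\<close> may be
  used.\<close>

lemma cover_symplectic_eq:
  assumes V: "V \<in> tangent_space B (cover_pt p s)" and W: "W \<in> tangent_space B (cover_pt p s)"
    and s: "s \<noteq> 0" and c: "c \<in> A" "p \<in> fst c"
  shows "cover_symplectic A \<eta> (cover_pt p s) V W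
    = s * ext_deriv A \<eta> p (base_vec p V) (base_vec p W)
      + snd (V (K c)) * \<eta> p (base_vec p W) - snd (W (K c)) * \<eta> p (base_vec p V)"
proof -
  have p: "p \<in> carrier_of A" using c in_carrier by blast
  have "cover_pt p s \<in> carrier_of B" using p s by (rule cover_pt_in_carrier)
  then obtain d where d: "d \<in> A" "p \<in> fst d" "chart_at B (cover_pt p s) = K d"
    using cover.chart_at s by (metis cover_atlasE cover_pt_in_chart)
  note base = base_vec_in_tangent_space[OF V s] base_vec_in_tangent_space[OF W s]
  have b: "base_vec p V d = fst (V (K d))" "base_vec p W d = fst (W (K d))"
    using d by (simp_all add: base_vec_def)
  have "cover_symplectic A \<eta> (cover_pt p s) V W
      = s * local_ext_deriv A \<eta> d (snd d p) (fst (V (K d))) (fst (W (K d)))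
      + snd (V (K d)) * coord_form A \<eta> d (snd d p) (fst (W (K d)))
      - snd (W (K d)) * coord_form A \<eta> d (snd d p) (fst (V (K d)))"
    using d s p by (simp add: cover_symplectic_def ext_deriv_def Let_def snd_cover_chart
        coord_form_cover_derivative local_ext_deriv_def algebra_simps)
  also have "\<dots> = s * ext_deriv A \<eta> p (base_vec p V) (base_vec p W)
      + snd (V (K d)) * \<eta> p (base_vec p W) - snd (W (K d)) * \<eta> p (base_vec p V)"
    using ext_deriv_eq_local[OF d(1,2) base] form_eq_coord_form[OF d(1,2) base(1)]
      form_eq_coord_form[OF d(1,2) base(2)] by (simp add: b)
  finally show ?thesis
    using cover_tangent_transition[OF V s d(1,2) c] cover_tangent_transition[OF W s d(1,2) c] by simp
qed

section \<open>Tangent spaces of the preimage of a subset\<close>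

text \<open>A curve in the preimage projects to a curve in \<open>N\<close>, and in charts the
  projection drops the last coordinate.\<close>

lemma base_vec_tangent_space_on:
  assumes V: "V \<in> tangent_space_on B (cover_preimage A \<eta> N) q"
  shows "base_vec (fst q) V \<in> tangent_space_on A N (fst q)"
proof -
  obtain \<gamma> \<epsilon> where V: "V = velocity B \<gamma> 0" and \<epsilon>: "0 < \<epsilon>"
    and \<gamma>: "smooth_curve B {-\<epsilon><..<\<epsilon>} \<gamma>" "\<gamma> 0 = q"
    and N: "\<And>t. t \<in> {-\<epsilon><..<\<epsilon>} \<Longrightarrow> \<gamma> t \<in> cover_preimage A \<eta> N"
    using V unfolding tangent_space_on_def by blast
  let ?I = "{-\<epsilon><..<\<epsilon>}" and ?\<delta> = "fst \<circ> \<gamma>"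
  have pts: "\<gamma> t \<in> cover_points A \<eta>" "?\<delta> t \<in> N" "?\<delta> t \<in> carrier_of A" if "t \<in> ?I" for t
    using N[OF that] by (auto simp: cover_preimage_def elim!: cover_pointsE)
  have dom: "{t\<in>?I. ?\<delta> t \<in> fst c} = {t\<in>?I. \<gamma> t \<in> fst (K c)}" for c
    using pts by (auto simp: in_cover_chart)
  have loc: "snd c \<circ> ?\<delta> = (\<lambda>t. fst ((snd (K c) \<circ> \<gamma>) t))" for c
    by (simp add: fun_eq_iff fst_snd_cover_chart)
  have sm: "smooth_curve A ?I ?\<delta>"
    unfolding smooth_curve_def
  proof (intro conjI ballI)
    show "?\<delta> ` ?I \<subseteq> carrier_of A" using pts by blast
    fix c assume "c \<in> A"
    then have *: "open {t\<in>?I. \<gamma> t \<in> fst (K c)} \<and> smooth_on {t\<in>?I. \<gamma> t \<in> fst (K c)} (snd (K c) \<circ> \<gamma>)"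
      using \<gamma>(1) K_in_B unfolding smooth_curve_def by blast
    then show "open {t\<in>?I. ?\<delta> t \<in> fst c}" unfolding dom by blast
    show "smooth_on {t\<in>?I. ?\<delta> t \<in> fst c} (snd c \<circ> ?\<delta>)"
      unfolding dom loc using * smooth_on_linear_image[OF _ bounded_linear_fst] by blast
  qed
  have "base_vec (fst q) V = velocity A ?\<delta> 0"
  proof
    fix c
    show "base_vec (fst q) V c = velocity A ?\<delta> 0 c"
    proof (cases "c \<in> A \<and> fst q \<in> fst c")
      case True
      then have "((snd (K c) \<circ> \<gamma>) has_vector_derivative V (K c)) (at 0)"
        using cover.smooth_curve_has_vector_derivative[OF \<gamma>(1), of 0 "K c"] \<epsilon> \<gamma>(2) pts(1)[of 0] V
        by (simp add: K_in_B in_cover_chart)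
      then have "((snd c \<circ> ?\<delta>) has_vector_derivative fst (V (K c))) (at 0)"
        unfolding loc by (rule bounded_linear.has_vector_derivative[OF bounded_linear_fst])
      then show ?thesis using True \<gamma>(2) by (simp add: base_vec_def velocity_def vector_derivative_at)
    qed (use \<gamma>(2) in \<open>auto simp: base_vec_def velocity_def\<close>)
  qed
  then show ?thesis
    unfolding tangent_space_on_def using sm \<epsilon> \<gamma>(2) pts(2) by force
qed

text \<open>The converse inclusion: a curve in \<open>N\<close> lifts with any prescribed fibre
  velocity \<sigma>.\<close>

lemma tangent_space_on_lift:
  assumes v: "v \<in> tangent_space_on A N p" and s: "s \<noteq> 0"
  obtains V where "V \<in> tangent_space_on B (cover_preimage A \<eta> N) (cover_pt p s)"
    "base_vec p V = v" "\<And>c. c \<in> A \<Longrightarrow> p \<in> fst c \<Longrightarrow> snd (V (K c)) = \<sigma>"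
proof -
  obtain \<gamma> \<epsilon> where v: "v = velocity A \<gamma> 0" and \<epsilon>: "0 < \<epsilon>"
    and \<gamma>: "smooth_curve A {-\<epsilon><..<\<epsilon>} \<gamma>" "\<gamma> 0 = p" and N: "\<And>t. t \<in> {-\<epsilon><..<\<epsilon>} \<Longrightarrow> \<gamma> t \<in> N"
    using v unfolding tangent_space_on_def by blast
  \<comment> \<open>For |t| below the second bound, |t \<sigma>| < |s|, so the factor s + t \<sigma>
    never reaches 0. The summand 1 covers \<sigma> = 0.\<close>
  define \<delta> where "\<delta> = min \<epsilon> (\<bar>s\<bar> / (\<bar>\<sigma>\<bar> + 1))"
  have \<delta>: "0 < \<delta>" using \<epsilon> s by (simp add: \<delta>_def add_nonneg_pos)
  let ?I = "{-\<delta><..<\<delta>}"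
  have I: "t \<in> {-\<epsilon><..<\<epsilon>}" if "t \<in> ?I" for t using that by (auto simp: \<delta>_def)
  have ne: "s + t * \<sigma> \<noteq> 0" if "t \<in> ?I" for t
  proof -
    have "\<bar>t\<bar> < \<bar>s\<bar> / (\<bar>\<sigma>\<bar> + 1)" using that by (auto simp: \<delta>_def)
    then have "\<bar>t\<bar> * (\<bar>\<sigma>\<bar> + 1) < \<bar>s\<bar>" by (simp add: pos_less_divide_eq add_nonneg_pos)
    then have "\<bar>t * \<sigma>\<bar> < \<bar>s\<bar>" by (simp add: abs_mult algebra_simps)
    then show ?thesis by linarith
  qed
  define \<beta> where "\<beta> t = cover_pt (\<gamma> t) (s + t * \<sigma>)" for t
  have car: "\<gamma> t \<in> carrier_of A" if "t \<in> ?I" for t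
    using \<gamma>(1) I[OF that] by (auto simp: smooth_curve_def)
  have pts: "\<beta> t \<in> cover_points A \<eta>" if "t \<in> ?I" for t
    using that car ne by (simp add: \<beta>_def cover_pt_in_cover_points)
  have dom: "{t\<in>?I. \<beta> t \<in> fst (K c)} = ?I \<inter> {t\<in>{-\<epsilon><..<\<epsilon>}. \<gamma> t \<in> fst c}" for c
    using pts I by (auto simp: in_cover_chart \<beta>_def)
  have loc: "(snd (K c) \<circ> \<beta>) t = ((snd c \<circ> \<gamma>) t, s + t *\<^sub>R \<sigma>)" if "t \<in> ?I" for c t
    using car[OF that] by (simp add: \<beta>_def snd_cover_chart)
  have sm: "smooth_curve B ?I \<beta>"
    unfolding smooth_curve_def
  proof (intro conjI ballI)
    show "\<beta> ` ?I \<subseteq> carrier_of B"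
      unfolding \<beta>_def using cover_pt_in_carrier car ne by blast
    fix C assume "C \<in> B"
    then obtain c where c: "c \<in> A" "C = K c" by (rule cover_atlasE)
    let ?J = "?I \<inter> {t\<in>{-\<epsilon><..<\<epsilon>}. \<gamma> t \<in> fst c}"
    have o: "open ?J" and g: "smooth_on ?J (snd c \<circ> \<gamma>)"
      using \<gamma>(1) c(1) by (auto simp: smooth_curve_def intro!: open_Int intro: smooth_on_subset)
    show "open {t\<in>?I. \<beta> t \<in> fst C}" unfolding c(2) dom by (rule o)
    have "smooth_on ?J (\<lambda>t. ((snd c \<circ> \<gamma>) t, s + t *\<^sub>R \<sigma>))"
      by (rule smooth_on_Pair[OF o g smooth_on_affine])
    then show "smooth_on {t\<in>?I. \<beta> t \<in> fst C} (snd C \<circ> \<beta>)"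
      unfolding c(2) dom by (subst smooth_on_cong[OF o]) (auto simp: loc simp del: o_apply)
  qed
  have 0: "0 \<in> ?I" using \<delta> by simp
  have q: "\<beta> 0 = cover_pt p s" by (simp add: \<beta>_def \<gamma>(2))
  have vel: "velocity B \<beta> 0 (K c) = (v c, \<sigma>)" if c: "c \<in> A" "p \<in> fst c" for c
  proof -
    have "((snd c \<circ> \<gamma>) has_vector_derivative v c) (at 0)"
      using smooth_curve_has_vector_derivative[OF \<gamma>(1), of 0 c] \<epsilon> \<gamma>(2) c v by simp
    moreover have "((\<lambda>t. s + t *\<^sub>R \<sigma>) has_vector_derivative \<sigma>) (at 0)"
      by (auto intro!: derivative_eq_intros)
    ultimately have "((\<lambda>t. ((snd c \<circ> \<gamma>) t, s + t *\<^sub>R \<sigma>)) has_vector_derivative (v c, \<sigma>)) (at 0)"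
      by (rule has_vector_derivative_Pair)
    then have "((snd (K c) \<circ> \<beta>) has_vector_derivative (v c, \<sigma>)) (at 0)"
      by (rule has_vector_derivative_transform_within_open[OF _ _ 0]) (simp_all add: loc del: o_apply)
    then show ?thesis
      using c s by (simp add: velocity_def q K_in_B cover_pt_in_chart vector_derivative_at)
  qed
  show ?thesis
  proof
    show "velocity B \<beta> 0 \<in> tangent_space_on B (cover_preimage A \<eta> N) (cover_pt p s)"
      unfolding tangent_space_on_def using sm \<delta> q pts N I
      by (force simp: cover_preimage_def \<beta>_def)
    show "base_vec p (velocity B \<beta> 0) = v"
    proof
      fix c show "base_vec p (velocity B \<beta> 0) c = v c"
        using vel[of c] \<gamma>(2) by (auto simp: base_vec_def v velocity_def)
    qed
  qed (simp add: vel)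
qed

section \<open>Isotropy and coisotropy read on the base\<close>

text \<open>At factor 1 both (v, 0) and (v, 1) are tangent to the preimage, and \<Omega>((v, 0), (v,
  1)) = d\<eta>(v, v) - \<eta>(v) = -\<eta>(v). The pair (v, 0), (w, 0) then gives d\<eta>(v,
  w).\<close>

lemma isotropic_imp:
  assumes iso: "isotropic A \<eta> N" and N: "N \<subseteq> carrier_of A" "p \<in> N"
    and v: "v \<in> tangent_space_on A N p"
  shows "\<eta> p v = 0" and "w \<in> tangent_space_on A N p \<Longrightarrow> ext_deriv A \<eta> p v w = 0"
proof -
  let ?q = "cover_pt p 1"
  let ?T = "tangent_space_on B (cover_preimage A \<eta> N) ?q"
  obtain c where c: "c \<in> A" "p \<in> fst c" using N by (auto simp: carrier_of_def)
  have q: "?q \<in> cover_preimage A \<eta> N"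
    using N cover_pt_in_cover_points[of p 1] by (auto simp: cover_preimage_def)
  then have orth: "cover_symplectic A \<eta> ?q V W = 0" if "V \<in> ?T" "W \<in> ?T" for V W
    using iso that by (auto simp: isotropic_def Let_def orthogonal_space_def)
  have T: "V \<in> tangent_space B ?q" if "V \<in> ?T" for V
    using that cover.tangent_space_on_subset by blast
  obtain V where V: "V \<in> ?T" "base_vec p V = v" "snd (V (K c)) = 0"
    using tangent_space_on_lift[OF v, of 1 0] c by (metis zero_neq_one)
  obtain V' where V': "V' \<in> ?T" "base_vec p V' = v" "snd (V' (K c)) = 1"
    using tangent_space_on_lift[OF v, of 1 1] c by (metis zero_neq_one)
  have "ext_deriv A \<eta> p v v = 0" by (simp add: ext_deriv_def Let_def)
  then show "\<eta> p v = 0"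
    using orth[OF V(1) V'(1)] cover_symplectic_eq[OF T[OF V(1)] T[OF V'(1)] _ c] V V' by simp
  assume w: "w \<in> tangent_space_on A N p"
  obtain W where W: "W \<in> ?T" "base_vec p W = w" "snd (W (K c)) = 0"
    using tangent_space_on_lift[OF w, of 1 0] c by (metis zero_neq_one)
  show "ext_deriv A \<eta> p v w = 0"
    using orth[OF V(1) W(1)] cover_symplectic_eq[OF T[OF V(1)] T[OF W(1)] _ c] V W by simp
qed

text \<open>At factor 1, \<Omega>((v, 0), (w, b)) = d\<eta>(v, w) - b \<eta>(v), so the conditions
  on \<open>v\<close> make (v, 0) orthogonal to the preimage. Coisotropy turns it into the velocity
  of a curve there, whose projection has velocity \<open>v\<close>.\<close>

lemma coisotropic_imp:
  assumes co: "coisotropic A \<eta> N" and N: "N \<subseteq> carrier_of A" "p \<in> N"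
    and v: "v \<in> tangent_space A p" "\<eta> p v = 0"
    and orth: "\<And>w. w \<in> tangent_space_on A N p \<Longrightarrow> ext_deriv A \<eta> p v w = 0"
  shows "v \<in> tangent_space_on A N p"
proof -
  let ?q = "cover_pt p 1"
  let ?T = "tangent_space_on B (cover_preimage A \<eta> N) ?q"
  obtain c where c: "c \<in> A" "p \<in> fst c" using N by (auto simp: carrier_of_def)
  have q: "?q \<in> cover_preimage A \<eta> N"
    using N cover_pt_in_cover_points[of p 1] by (auto simp: cover_preimage_def)
  \<comment> \<open>No curve in \<open>N\<close> with velocity \<open>v\<close> is known yet, so (v,
    0) is built from its coordinates instead of by lifting.\<close>
  define V where "V = coord_vec B (K c) ?q (v c, 0)"
  have KB: "K c \<in> B" "?q \<in> fst (K c)" using c by (simp_all add: K_in_B cover_pt_in_chart)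
  have V: "V \<in> tangent_space B ?q" "snd (V (K c)) = 0"
    using cover.coord_vec_in_tangent_space[OF KB] cover.coord_vec_self[OF KB] by (simp_all add: V_def)
  have bV: "base_vec p V = v"
    using base_vec_coord_vec[OF c, of 1] coord_vec_of_tangent[OF v(1) c] by (simp add: V_def)
  have "cover_symplectic A \<eta> ?q V W = 0" if W: "W \<in> ?T" for W
  proof -
    have "W \<in> tangent_space B ?q" using W cover.tangent_space_on_subset by blast
    from cover_symplectic_eq[OF V(1) this _ c] show ?thesis
      using V(2) bV v(2) orth[of "base_vec p W"] base_vec_tangent_space_on[OF W] by simp
  qed
  then have "V \<in> orthogonal_space B (cover_symplectic A \<eta>) ?q ?T"
    using V(1) by (simp add: orthogonal_space_def)
  then have "V \<in> ?T" using co q by (auto simp: coisotropic_def Let_def)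
  from base_vec_tangent_space_on[OF this] show ?thesis by (simp add: bV)
qed

end

section \<open>The evolution field\<close>

text \<open>Cartan's formula for \<alpha>(X) = -H. The derivative of \<alpha>(X) in the chart is
  computed twice, by the product rule in \<open>D1\<close> and as -dH in \<open>D2\<close>, and the
  results are compared.\<close>

lemma (in one_form_atlas) ext_deriv_by_lie_deriv:
  assumes X: "smooth_vector_field A X" and H: "smooth_function A H"
    and \<alpha>X: "\<And>p. p \<in> carrier_of A \<Longrightarrow> \<alpha> p (X p) = - H p"
    and p: "p \<in> carrier_of A"
  shows "ext_deriv A \<alpha> p (X p) v = lie_deriv A X \<alpha> p v + dir_deriv A H p v"
proof -
  let ?c = "chart_at A p"
  let ?x = "snd ?c p" and ?X = "\<lambda>y. X (chart_inv ?c y) ?c"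
  have c: "?c \<in> A" "p \<in> fst ?c" using chart_at[OF p] by auto
  then have x: "?x \<in> snd ?c ` fst ?c" by auto
  have Xx: "?X ?x = X p ?c" using c by (simp add: chart_inv_snd chart)
  have "(?X has_derivative frechet_derivative ?X (at ?x)) (at ?x)"
    using X c(1) x smooth_on_differentiable frechet_derivative_works
    unfolding smooth_vector_field_def by blast
  from coord_form_has_derivative[OF c(1) x this]
  have D1: "((\<lambda>y. coord_form A \<alpha> ?c y (?X y)) has_derivative
      (\<lambda>k. frechet_derivative (\<lambda>y. coord_form A \<alpha> ?c y (X p ?c)) (at ?x) k
        + coord_form A \<alpha> ?c ?x (frechet_derivative ?X (at ?x) k))) (at ?x)"
    by (simp add: Xx)
  have "((H \<circ> chart_inv ?c) has_derivative frechet_derivative (H \<circ> chart_inv ?c) (at ?x)) (at ?x)"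
    using H c(1) x smooth_on_differentiable frechet_derivative_works
    unfolding smooth_function_def by blast
  then have "((\<lambda>y. - (H \<circ> chart_inv ?c) y) has_derivative
      (\<lambda>k. - frechet_derivative (H \<circ> chart_inv ?c) (at ?x) k)) (at ?x)"
    by (rule has_derivative_minus)
  then have D2: "((\<lambda>y. coord_form A \<alpha> ?c y (?X y)) has_derivative
      (\<lambda>k. - frechet_derivative (H \<circ> chart_inv ?c) (at ?x) k)) (at ?x)"
  proof (rule has_derivative_transform_within_open[OF _ open_image[OF c(1)] x])
    fix y assume "y \<in> snd ?c ` fst ?c"
    then obtain q where q: "q \<in> fst ?c" "y = snd ?c q" by blast
    then have qA: "q \<in> carrier_of A" using c(1) unfolding carrier_of_def by blast
    then have "X q \<in> tangent_space A q" using X by (simp add: smooth_vector_field_def)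
    from form_eq_coord_form[OF c(1) q(1) this] show "- (H \<circ> chart_inv ?c) y = coord_form A \<alpha> ?c y (?X y)"
      using q \<alpha>X[OF qA] c(1) by (simp add: chart_inv_snd chart)
  qed
  from fun_cong[OF has_derivative_unique[OF D1 D2], of "v ?c"]
  show ?thesis by (simp add: ext_deriv_def lie_deriv_def dir_deriv_def Let_def)
qed

section \<open>Functions with vanishing derivative along a submanifold\<close>

lemma open_vimage_line:
  fixes S :: "'a::real_normed_vector set"
  shows "open S \<Longrightarrow> open {t::real. x + t *\<^sub>R v \<in> S}"
  using open_vimage[of S "\<lambda>t. x + t *\<^sub>R v"] by (simp add: vimage_def continuous_intros)

lemma (in differentiable_atlas) velocity_in_tangent_space_on:
  assumes \<gamma>: "smooth_curve A J \<gamma>" and J: "open J" "t \<in> J" and N: "\<And>u. u \<in> J \<Longrightarrow> \<gamma> u \<in> N"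
  shows "velocity A \<gamma> t \<in> tangent_space_on A N (\<gamma> t)"
proof -
  obtain e where e: "0 < e" "ball t e \<subseteq> J" using J openE by blast
  \<comment> \<open>\<open>tangent_space_on\<close> takes velocities at time 0 on symmetric
    intervals, so time is translated. Writing the shift with \<open>u *\<^sub>R 1\<close> makes it a
    line in the sense of \<open>smooth_on_compose_line\<close>.\<close>
  let ?I = "{-e<..<e}" and ?\<delta> = "\<lambda>u. \<gamma> (t + u *\<^sub>R 1)"
  have IJ: "t + u *\<^sub>R 1 \<in> J" if "u \<in> ?I" for u
    using that e(2) by (auto simp: subset_iff dist_real_def)
  have sm: "smooth_curve A ?I ?\<delta>"
    unfolding smooth_curve_def
  proof (intro conjI ballI)
    show "?\<delta> ` ?I \<subseteq> carrier_of A" using IJ \<gamma> by (auto simp: smooth_curve_def)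
    fix c assume c: "c \<in> A"
    let ?T = "{u\<in>J. \<gamma> u \<in> fst c}"
    have T: "open ?T" "smooth_on ?T (snd c \<circ> \<gamma>)" using \<gamma> c by (simp_all add: smooth_curve_def)
    have eq: "{u\<in>?I. ?\<delta> u \<in> fst c} = ?I \<inter> {u. t + u *\<^sub>R 1 \<in> ?T}" using IJ by blast
    show o: "open {u\<in>?I. ?\<delta> u \<in> fst c}"
      unfolding eq by (intro open_Int open_vimage_line T) simp
    have "smooth_on {u\<in>?I. ?\<delta> u \<in> fst c} (\<lambda>u. (snd c \<circ> \<gamma>) (t + u *\<^sub>R 1))"
      by (rule smooth_on_compose_line[OF o _ T(2)]) (use eq in blast)
    then show "smooth_on {u\<in>?I. ?\<delta> u \<in> fst c} (snd c \<circ> ?\<delta>)" by (simp add: o_def)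
  qed
  have "velocity A ?\<delta> 0 = velocity A \<gamma> t"
  proof
    fix c show "velocity A ?\<delta> 0 c = velocity A \<gamma> t c"
    proof (cases "c \<in> A \<and> \<gamma> t \<in> fst c")
      case True
      have 1: "((\<lambda>u. t + u *\<^sub>R 1) has_vector_derivative 1) (at 0)"
        by (auto intro!: derivative_eq_intros)
      have 2: "((snd c \<circ> \<gamma>) has_vector_derivative velocity A \<gamma> t c) (at (t + 0 *\<^sub>R 1))"
        using smooth_curve_has_vector_derivative[OF \<gamma> J(2)] True by simp
      have "((snd c \<circ> ?\<delta>) has_vector_derivative velocity A \<gamma> t c) (at 0)"
        using vector_diff_chain_at[OF 1 2] by (simp add: o_def)
      then show ?thesis using True by (simp add: velocity_def vector_derivative_at)
    qed (auto simp: velocity_def)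
  qed
  then show ?thesis
    unfolding tangent_space_on_def using sm e(1) N[OF IJ] by force
qed

lemma (in differentiable_atlas) dir_deriv_eq_0_of_constant:
  assumes f: "smooth_function A f" and N: "\<And>p. p \<in> N \<Longrightarrow> f p = a" and v: "v \<in> tangent_space_on A N p"
  shows "dir_deriv A f p v = 0"
proof -
  obtain \<gamma> e where v: "v = velocity A \<gamma> 0" and e: "0 < e"
    and \<gamma>: "smooth_curve A {-e<..<e} \<gamma>" "\<gamma> 0 = p" and "\<And>t. t \<in> {-e<..<e} \<Longrightarrow> \<gamma> t \<in> N"
    using v unfolding tangent_space_on_def by blast
  then have c: "f (\<gamma> t) = a" if "t \<in> {-e<..<e}" for t using N that by blast
  have 1: "((\<lambda>t. f (\<gamma> t)) has_real_derivative dir_deriv A f p v) (at 0)"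
    using dir_deriv_velocity[OF f \<gamma>(1), of 0] e \<gamma>(2) v by simp
  have "((\<lambda>t. a) has_real_derivative 0) (at 0)" by simp
  then have "((\<lambda>t. f (\<gamma> t)) has_real_derivative 0) (at 0)"
    by (rule has_field_derivative_transform_within_open[of _ _ _ "{-e<..<e}"]) (use e c in auto)
  with 1 show ?thesis by (rule DERIV_unique)
qed

context smooth_atlas
begin

text \<open>Source of the curves inside a submanifold: in a slice chart, lines in the slice are
  mapped into it. Smoothness is tested in the charts of \<open>A\<close>, hence the transition maps
  from \<open>d\<close>.\<close>

lemma chart_line_smooth_curve:
  fixes x v :: 'e
  assumes d: "d \<in> maximal_atlas A"
  defines "J \<equiv> {t::real. x + t *\<^sub>R v \<in> snd d ` fst d}"
  shows "smooth_curve A J (\<lambda>t. chart_inv d (x + t *\<^sub>R v))"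
proof -
  interpret M: smooth_atlas "insert d A" using d by (rule smooth_atlas_insert_maximal)
  have dM: "d \<in> insert d A" by simp
  have J: "chart_inv d (x + t *\<^sub>R v) \<in> fst d" if "t \<in> J" for t
    using that by (intro chart_inv_in) (simp add: J_def)
  show ?thesis
    unfolding smooth_curve_def
  proof (intro conjI ballI)
    show "(\<lambda>t. chart_inv d (x + t *\<^sub>R v)) ` J \<subseteq> carrier_of A"
      using J d by (auto simp: maximal_atlas_def)
    fix c assume "c \<in> A"
    then have cM: "c \<in> insert d A" by simp
    let ?S = "snd d ` (fst d \<inter> fst c)"
    have eq: "{t\<in>J. chart_inv d (x + t *\<^sub>R v) \<in> fst c} = {t. x + t *\<^sub>R v \<in> ?S}"
    proof (intro equalityI subsetI)
      fix t assume t: "t \<in> {t\<in>J. chart_inv d (x + t *\<^sub>R v) \<in> fst c}"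
      then have "chart_inv d (x + t *\<^sub>R v) \<in> fst d \<inter> fst c" using J by blast
      moreover have "snd d (chart_inv d (x + t *\<^sub>R v)) = x + t *\<^sub>R v"
        using t by (intro snd_chart_inv) (simp add: J_def)
      ultimately show "t \<in> {t. x + t *\<^sub>R v \<in> ?S}" by (metis image_eqI mem_Collect_eq)
    next
      fix t assume "t \<in> {t. x + t *\<^sub>R v \<in> ?S}"
      then obtain p where p: "p \<in> fst d" "p \<in> fst c" "x + t *\<^sub>R v = snd d p" by auto
      then show "t \<in> {t\<in>J. chart_inv d (x + t *\<^sub>R v) \<in> fst c}"
        by (simp add: J_def chart_inv_snd M.chart[OF dM])
    qed
    show o: "open {t\<in>J. chart_inv d (x + t *\<^sub>R v) \<in> fst c}"
      unfolding eq by (rule open_vimage_line[OF M.open_overlap[OF dM cM]])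
    have "snd c \<circ> (\<lambda>t. chart_inv d (x + t *\<^sub>R v)) = (\<lambda>t. transition d c (x + t *\<^sub>R v))"
      by (simp add: transition_def o_def)
    moreover have "smooth_on {t\<in>J. chart_inv d (x + t *\<^sub>R v) \<in> fst c} (\<lambda>t. transition d c (x + t *\<^sub>R v))"
      by (rule smooth_on_compose_line[OF o _ M.smooth_transition[OF dM cM]]) (use eq in blast)
    ultimately show "smooth_on {t\<in>J. chart_inv d (x + t *\<^sub>R v) \<in> fst c}
        (snd c \<circ> (\<lambda>t. chart_inv d (x + t *\<^sub>R v)))" by simp
  qed
qed

text \<open>In a slice chart, a ball around \<open>p\<close> meets the submanifold in a convex set.
  So \<open>p\<close> is joined to any nearby point of \<open>N\<close> by a segment inside
  \<open>N\<close>, along which the derivative of \<open>f\<close> is 0.\<close>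

lemma locally_constant_on_submanifold:
  assumes N: "submanifold A k N" and f: "smooth_function A f"
    and 0: "\<And>p v. p \<in> N \<Longrightarrow> v \<in> tangent_space_on A N p \<Longrightarrow> dir_deriv A f p v = 0"
    and p: "p \<in> N"
  obtains U where "openin (manifold_topology A) U" "p \<in> U" "\<And>q. q \<in> U \<inter> N \<Longrightarrow> f q = f p"
proof -
  obtain d S where d: "d \<in> maximal_atlas A" and pd: "p \<in> fst d" and S: "subspace S"
    and slice: "snd d ` (fst d \<inter> N) = snd d ` fst d \<inter> S"
    using N p unfolding submanifold_def by blast
  interpret M: smooth_atlas "insert d A" using d by (rule smooth_atlas_insert_maximal)
  have dM: "d \<in> insert d A" by simp
  note inv = chart_inv_snd[OF M.chart[OF dM]]
  obtain r where r: "0 < r" "ball (snd d p) r \<subseteq> snd d ` fst d"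
    using openE[OF M.open_image[OF dM], of "snd d p"] pd by auto
  define U where "U = {q \<in> fst d. snd d q \<in> ball (snd d p) r}"
  have "openin (manifold_topology A) U"
    unfolding openin_manifold_topology
  proof (intro conjI ballI)
    show "U \<subseteq> carrier_of A" using d by (auto simp: U_def maximal_atlas_def)
    fix c assume "c \<in> A"
    then have cM: "c \<in> insert d A" by simp
    \<comment> \<open>The topology is tested in the charts of \<open>A\<close>, while
      \<open>U\<close> is described in \<open>d\<close>; the transition map carries the condition
      over.\<close>
    have "snd c ` (U \<inter> fst c) = snd c ` (fst c \<inter> fst d) \<inter> transition c d -` ball (snd d p) r"
      by (auto simp: U_def transition_snd M.chart[OF cM])
    moreover have "open (snd c ` (fst c \<inter> fst d) \<inter> transition c d -` ball (snd d p) r)"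
      by (intro continuous_open_preimage smooth_on_continuous M.smooth_transition M.open_overlap cM dM
          open_ball)
    ultimately show "open (snd c ` (U \<inter> fst c))" by simp
  qed
  moreover have "p \<in> U" using pd r(1) by (simp add: U_def)
  moreover have "f q = f p" if q: "q \<in> U \<inter> N" for q
  proof -
    define x v where "x = snd d p" and "v = snd d q - snd d p"
    have qd: "q \<in> fst d" "snd d q \<in> ball x r" using q by (auto simp: U_def x_def)
    have xS: "x \<in> S" "snd d q \<in> S" using slice pd p qd q unfolding x_def by blast+
    have vS: "x + t *\<^sub>R v \<in> S" for t
      using xS S unfolding v_def x_def[symmetric] by (intro subspace_add subspace_scale subspace_diff)
    let ?\<gamma> = "\<lambda>t. chart_inv d (x + t *\<^sub>R v)" and ?J = "{t::real. x + t *\<^sub>R v \<in> snd d ` fst d}"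
    have sm: "smooth_curve A ?J ?\<gamma>" by (rule chart_line_smooth_curve[OF d])
    have oJ: "open ?J" by (rule open_vimage_line[OF M.open_image[OF dM]])
    have inN: "?\<gamma> t \<in> N" if "t \<in> ?J" for t
    proof -
      have "x + t *\<^sub>R v \<in> snd d ` (fst d \<inter> N)" using slice vS that by blast
      then obtain n where "n \<in> fst d" "n \<in> N" "x + t *\<^sub>R v = snd d n" by blast
      then show ?thesis by (simp add: inv)
    qed
    \<comment> \<open>Convexity of the ball keeps the segment in the image of \<open>d\<close>. The
      curve lives on the larger open set \<open>?J\<close>, which supplies two-sided derivatives at
      the end points 0 and 1.\<close>
    have seg: "t \<in> ?J" if "0 \<le> t" "t \<le> 1" for t
    proof -
      have "x + t *\<^sub>R v = (1 - t) *\<^sub>R x + t *\<^sub>R snd d q" by (simp add: v_def x_def algebra_simps)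
      also have "\<dots> \<in> ball x r"
        using that qd(2) r(1) by (intro convexD[OF convex_ball]) auto
      finally show ?thesis using r(2) by (auto simp: x_def)
    qed
    have "((\<lambda>t. f (?\<gamma> t)) has_real_derivative 0) (at t)" if "0 \<le> t" "t \<le> 1" for t
      using dir_deriv_velocity[OF f sm seg[OF that]]
        0[OF inN[OF seg[OF that]] velocity_in_tangent_space_on[OF sm oJ seg[OF that] inN]] by simp
    from MVT2[of 0 1, OF _ this] have "f (?\<gamma> 1) = f (?\<gamma> 0)" by auto
    then show ?thesis using inv[OF qd(1)] inv[OF pd] by (simp add: v_def x_def)
  qed
  ultimately show ?thesis using that by blast
qed

lemma constant_on_connected_submanifold:
  assumes N: "submanifold A k N" and f: "smooth_function A f"
    and 0: "\<And>p v. p \<in> N \<Longrightarrow> v \<in> tangent_space_on A N p \<Longrightarrow> dir_deriv A f p v = 0"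
    and conn: "connectedin (manifold_topology A) N"
  shows "\<exists>a. \<forall>p\<in>N. f p = a"
proof (cases "N = {}")
  case False
  then obtain p where p: "p \<in> N" by blast
  have "\<exists>U. openin (manifold_topology A) U \<and> q \<in> U \<and> (\<forall>r \<in> U \<inter> N. f r = f q)" if "q \<in> N" for q
    using locally_constant_on_submanifold[OF N f 0 that] by metis
  then obtain U where U: "\<And>q. q \<in> N \<Longrightarrow> openin (manifold_topology A) (U q)"
      "\<And>q. q \<in> N \<Longrightarrow> q \<in> U q" "\<And>q r. q \<in> N \<Longrightarrow> r \<in> U q \<inter> N \<Longrightarrow> f r = f q"
    by metis
  \<comment> \<open>\<open>E1\<close> and \<open>E2\<close> may overlap, but not on
    \<open>N\<close>, where they separate the points with value \<open>f p\<close> from the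
    others.\<close>
  define E1 E2 where "E1 = (\<Union>q\<in>{q\<in>N. f q = f p}. U q)" and "E2 = (\<Union>q\<in>{q\<in>N. f q \<noteq> f p}. U q)"
  have "openin (manifold_topology A) E1" "openin (manifold_topology A) E2"
    unfolding E1_def E2_def using U(1) by (auto intro!: openin_Union)
  moreover have "N \<subseteq> E1 \<union> E2" unfolding E1_def E2_def using U(2) by blast
  moreover have "f r = f p" if "r \<in> E1 \<inter> N" for r using that U(3) unfolding E1_def by force
  moreover have "f r \<noteq> f p" if "r \<in> E2 \<inter> N" for r using that U(3) unfolding E2_def by force
  moreover have "p \<in> E1 \<inter> N" unfolding E1_def using U(2) p by blast
  ultimately have "E2 \<inter> N = {}" using conn unfolding connectedin by blast
  then have "f q = f p" if "q \<in> N" for q using that U(2) unfolding E2_def by blast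
  then show ?thesis by blast
qed simp

end

section \<open>The equivalence for Legendrian submanifolds\<close>

theorem theorem4p4:
  fixes A :: "('p, 'e::euclidean_space) chart set"
    and \<eta> :: "'p \<Rightarrow> ('p, 'e) tvec \<Rightarrow> real"
    and H :: "'p \<Rightarrow> real"
    and R X :: "'p \<Rightarrow> ('p, 'e) tvec"
    and L :: "'p set"
  assumes "contact_hamiltonian_system A \<eta> H"
    and "reeb_field A \<eta> R"
    and "hamiltonian_field A \<eta> H R X"
    and "legendrian_submanifold A \<eta> L"
    and "connectedin (manifold_topology A) L"
  shows "tangent_to A (evolution_field H R X) L \<longleftrightarrow> (\<exists>a. \<forall>p\<in>L. H p = a)"
proof -
  have man: "smooth_manifold A" and con: "contact_form A \<eta>" and H: "smooth_function A H"
    using assms(1) unfolding contact_hamiltonian_system_def by blast+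
  interpret smooth_atlas A using man by (rule smooth_manifold_imp_smooth_atlas)
  interpret nowhere_zero_form_atlas A \<eta>
    by unfold_locales (use con in \<open>auto simp: contact_form_def\<close>)
  obtain k where sub: "submanifold A k L" and iso: "isotropic A \<eta> L" and co: "coisotropic A \<eta> L"
    using assms(4) by (auto simp: legendrian_submanifold_def)
  have LA: "L \<subseteq> carrier_of A" using sub by (simp add: submanifold_def)
  have R: "R p \<in> tangent_space A p" "\<eta> p (R p) = 1"
      "\<And>v. v \<in> tangent_space A p \<Longrightarrow> ext_deriv A \<eta> p (R p) v = 0" if "p \<in> carrier_of A" for p
    using assms(2) that by (simp_all add: reeb_field_def smooth_vector_field_def)
  have X: "smooth_vector_field A X" and \<eta>X: "\<And>p. p \<in> carrier_of A \<Longrightarrow> \<eta> p (X p) = - H p"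
    and lie: "\<And>p v. p \<in> carrier_of A \<Longrightarrow> v \<in> tangent_space A p \<Longrightarrow>
        lie_deriv A X \<eta> p v = - dir_deriv A H p (R p) * \<eta> p v"
    using assms(3) by (simp_all add: hamiltonian_field_def)
  have XT: "X p \<in> tangent_space A p" if "p \<in> carrier_of A" for p
    using X that by (simp add: smooth_vector_field_def)
  let ?E = "evolution_field H R X"
  have E_tangent: "?E p \<in> tangent_space A p" and \<eta>E: "\<eta> p (?E p) = 0" if p: "p \<in> carrier_of A" for p
    using tangent_space_combination[OF XT[OF p] R(1)[OF p], of 1 "H p"]
      form_combination[OF p XT[OF p] R(1)[OF p], of 1 "H p"] \<eta>X[OF p] R(2)[OF p]
    by (simp_all add: evolution_field_def[abs_def])
  \<comment> \<open>The Reeb summand drops out by i_R d\<eta> = 0; the rest is Cartan's formula for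
    X with the equation for its Lie derivative inserted.\<close>
  have d\<eta>E: "ext_deriv A \<eta> p (?E p) v = dir_deriv A H p v - dir_deriv A H p (R p) * \<eta> p v"
    if p: "p \<in> carrier_of A" and v: "v \<in> tangent_space A p" for p v
    using ext_deriv_add_scaled[OF p XT[OF p] R(1)[OF p], of "H p" v] R(3)[OF p v]
      ext_deriv_by_lie_deriv[OF X H \<eta>X p, of v] lie[OF p v]
    by (simp add: evolution_field_def[abs_def])
  have TL: "v \<in> tangent_space A p" if "v \<in> tangent_space_on A L p" for v p
    using that tangent_space_on_subset by blast
  have d\<eta>E_L: "ext_deriv A \<eta> p (?E p) v = dir_deriv A H p v"
    if "p \<in> L" "v \<in> tangent_space_on A L p" for p v
    using that LA d\<eta>E[of p v] TL isotropic_imp(1)[OF iso LA that] by auto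
  show ?thesis
  proof
    assume tan: "tangent_to A ?E L"
    have "dir_deriv A H p v = 0" if "p \<in> L" "v \<in> tangent_space_on A L p" for p v
    proof -
      have "?E p \<in> tangent_space_on A L p" using tan that(1) by (simp add: tangent_to_def)
      from isotropic_imp(2)[OF iso LA that(1) this that(2)] show ?thesis by (simp add: d\<eta>E_L[OF that])
    qed
    from constant_on_connected_submanifold[OF sub H this assms(5)]
    show "\<exists>a. \<forall>p\<in>L. H p = a" .
  next
    assume "\<exists>a. \<forall>p\<in>L. H p = a"
    then obtain a where a: "\<And>p. p \<in> L \<Longrightarrow> H p = a" by blast
    show "tangent_to A ?E L"
      unfolding tangent_to_def
    proof
      fix p assume p: "p \<in> L"
      then have pA: "p \<in> carrier_of A" using LA by blast
      show "?E p \<in> tangent_space_on A L p"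
        by (rule coisotropic_imp[OF co LA p E_tangent[OF pA] \<eta>E[OF pA]])
          (simp add: d\<eta>E_L[OF p] dir_deriv_eq_0_of_constant[OF H a])
    qed
  qed
qed

end
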